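(* Suppose $\mathcal B$ is a normal $\mathfrak q_n^+$-crystal. Then $b\in\mathcal B$ is a $\mathfrak q_n^+$-lowest weight element if and only if $\sigma_{w_0^+}(b)\in\mathcal B$ is a $\mathfrak q_n^+$-highest weight element.
   Context: **Notation.** $n$ is a positive integer; $\mathbb N=\{0,1,2,\dots\}$, $[k]=\{1,\dots,k\}$, $[p,q]=\{i\in\mathbb Z:p\le i\le q\}$; $\mathbf e_1,\dots,\mathbf e_n$ is the standard basis of $\mathbb Z^n$. **Crystals.** All crystals are nonempty sets $\mathcal B$ with a weight map $\mathrm{wt}:\mathcal B\to\mathbb Z^n$ and raising/lowering operators $e_i,f_i:\mathcal B\to\mathcal B\sqcup\{0\}$, where $0\notin\mathcal B$ is an auxiliary element (operators send $0$ to $0$). Put $\varepsilon_i(b)=\max\{k\in\mathbb N:e_i^k(b)\ne0\}$ and $\varphi_i(b)=\max\{k\in\mathbb N:f_i^k(b)\ne0\}$ in $\mathbb N\sqcup\{\infty\}$. A *$\mathfrak{gl}_n$-crystal* has operators indexed by $i\in[n-1]$ such that for all $b,c\in\mathcal B$ and $i\in[n-1]$: (S1) $e_i(b)=c$ iff $f_i(c)=b$, in which case $\mathrm{wt}(c)-\mathrm{wt}(b)=\mathbf e_i-\mathbf e_{i+1}$; (S2) $\varepsilon_i(b),\varphi_i(b)$ are finite and $\varphi_i(b)-\varepsilon_i(b)=\mathrm{wt}(b)_i-\mathrm{wt}(b)_{i+1}$. For $n\ge2$, a *$\mathfrak q_n$-crystal* is a $\mathfrak{gl}_n$-crystal with $\mathrm{wt}(\mathcal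 B)\subset\mathbb N^n$ and additional operators $e_{\bar1},f_{\bar1}$ such that for all $b,c\in\mathcal B$: (P1) $e_{\bar1}(b)=c$ iff $f_{\bar1}(c)=b$, in which case $\mathrm{wt}(c)-\mathrm{wt}(b)=\mathbf e_1-\mathbf e_2$ and $\varepsilon_i(b)=\varepsilon_i(c)$, $\varphi_i(b)=\varphi_i(c)$ for $i\in[3,n-1]$; (P2) for $i\in[3,n-1]$, $e_i,f_i$ commute with $e_{\bar1},f_{\bar1}$; (P3) $(\varepsilon_{\bar1}+\varphi_{\bar1})(b)=0$ if $\mathrm{wt}(b)_1=\mathrm{wt}(b)_2=0$, and $=1$ otherwise. A *$\mathfrak q_1$-crystal* is a nonempty set with a map $\mathrm{wt}:\mathcal B\to\mathbb N$. A *$\mathfrak q_n^+$-crystal* is a $\mathfrak q_n$-crystal with additional operators $e_0,f_0$ such that for all $b,c\in\mathcal B$: (Q1) $e_0(b)=c$ iff $f_0(c)=b$, in which case $\mathrm{wt}(b)=\mathrm{wt}(c)$ and $\varepsilon_i(b)=\varepsilon_i(c)$, $\varphi_i(b)=\varphi_i(c)$ for all $i\in[n-1]$ and also for $i=\bar1$ if $n\ge2$; (Q2) for $i\in[2,n-1]$, $e_i,f_i$ commute with $e_0,f_0$; (Q3) $(\varepsilon_0+\varphi_0)(b)=0$ if $\mathrm{wt}(b)_1=0$, and $=1$ otherwise. The *crystal graph* has vertex set $\mathcal B$ and an edge $b\xrightarrow{i}c$ whenever $f_i(b)=c\neq0$. The weakly connected components of this graph, with inherited structure, are the *full subcrystals*.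 An *isomorphism* is a weight-preserving bijection giving an isomorphism of labeled crystal graphs. **Tensor product.** For $\mathfrak q_n^+$-crystals $\mathcal B,\mathcal C$, the set $\mathcal B\otimes\mathcal C=\{b\otimes c\}$ is a $\mathfrak q_n^+$-crystal with $\mathrm{wt}(b\otimes c)=\mathrm{wt}(b)+\mathrm{wt}(c)$ and (with $b\otimes0=0\otimes c=0$) the following operators. For $i\in[n-1]$: $e_i(b\otimes c)=b\otimes e_i(c)$ if $\varepsilon_i(b)\le\varphi_i(c)$, else $e_i(b)\otimes c$; $f_i(b\otimes c)=b\otimes f_i(c)$ if $\varepsilon_i(b)<\varphi_i(c)$, else $f_i(b)\otimes c$. For $g\in\{e_0,f_0\}$: $g(b\otimes c)=g(b)\otimes c$ if $\mathrm{wt}(b)_1\ne0$, else $b\otimes g(c)$. If $n\ge2$: $e_{\bar1}(b\otimes c)$ equals $b\otimes e_{\bar1}(c)$ if $\mathrm{wt}(b)_1=\mathrm{wt}(b)_2=0$; $f_0e_{\bar1}(b)\otimes e_0(c)$ if $\mathrm{wt}(b)_1=0$, $f_0e_{\bar1}(b)\ne0$, $e_0(c)\neq0$; $e_0e_{\bar1}(b)\otimes f_0(c)$ if $\mathrm{wt}(b)_1=0$, $e_0e_{\bar1}(b)\neq0$, $f_0(c)\ne0$; and $e_{\bar1}(b)\otimes c$ otherwise. And $f_{\bar1}(b\otimes c)$ equals $b\otimes f_{\bar1}(c)$ if $\mathrm{wt}(b)_1=\mathrm{wt}(b)_2=0$; $f_{\bar1}f_0(b)\otimes e_0(c)$ if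 $\mathrm{wt}(b)_1=1$, $f_{\bar1}f_0(b)\ne0$, $e_0(c)\ne0$; $f_{\bar1}e_0(b)\otimes f_0(c)$ if $\mathrm{wt}(b)_1=1$, $f_{\bar1}e_0(b)\ne0$, $f_0(c)\neq0$; and $f_{\bar1}(b)\otimes c$ otherwise. This tensor product is associative. **Normal crystals.** The *standard $\mathfrak q_n^+$-crystal* $\mathbb B_n^+$ has $2n$ elements $\boxed{i},\boxed{i'}$ ($i\in[n]$), both of weight $\mathbf e_i$, with $f_i:\boxed{i}\mapsto\boxed{i+1}$, $\boxed{i'}\mapsto\boxed{(i+1)'}$ for $i\in[n-1]$; $f_{\bar1}:\boxed1\mapsto\boxed2$, $\boxed{1'}\mapsto\boxed{2'}$ (if $n\ge2$); $f_0:\boxed1\mapsto\boxed{1'}$; all other values of the $f$'s are $0$, and the $e$'s are the partial inverses. $(\mathbb B_n^+)^{\otimes0}$ is the one-element crystal of weight $0$. A $\mathfrak q_n^+$-crystal is *normal* if each of its full subcrystals is isomorphic to a full subcrystal of $(\mathbb B_n^+)^{\otimes m}$ for some $m\in\mathbb N$. **Highest and lowest weight elements.** For $i\in\{0\}\cup[n-1]$ let $\sigma_i(b)=f_i^k(b)$ if $k\ge0$ and $e_i^{-k}(b)$ if $k\le0$, where $k=\varphi_i(b)-\varepsilon_i(b)$; $\sigma_i(0)=0$. For $i\in[2,n-1]$ let $e_{\bar i}=\sigma_{i-1}\sigma_i\,e_{\overline{i-1}}\,\sigma_i\sigma_{i-1}$. Let $\sigma_{w_0}=(\sigma_1)(\sigma_2\sigma_1)(\sigma_3\sigma_2\sigma_1)\cdots(\sigma_{n-1}\cdots\sigma_2\sigma_1)$,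 and for $i\in[n-1]$ let $f_{\bar i'}=\sigma_{w_0}\,e_{\overline{n-i}}\,\sigma_{w_0}^{-1}$. For $i\in[n]$ let $e_0^{[i]}=\sigma_{i-1}\cdots\sigma_1e_0\sigma_1\cdots\sigma_{i-1}$ and $f_0^{[i]}=\sigma_{i-1}\cdots\sigma_1f_0\sigma_1\cdots\sigma_{i-1}$. A *$\mathfrak q_n^+$-highest weight element* is $b\in\mathcal B$ with $e_i(b)=e_{\bar i}(b)=0$ for all $i\in[n-1]$ and $e_0^{[i]}(b)=0$ for all $i\in[n]$. A *$\mathfrak q_n^+$-lowest weight element* is $b\in\mathcal B$ with $f_i(b)=f_{\bar i'}(b)=0$ for all $i\in[n-1]$ and $f_0^{[i]}(b)=0$ for all $i\in[n]$. **The operator in the claim.** $\sigma_{w_0^+}=(\sigma_0)(\sigma_1\sigma_0)(\sigma_2\sigma_1\sigma_0)\cdots(\sigma_{n-1}\cdots\sigma_1\sigma_0):\mathcal B\to\mathcal B$. *)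

theory Defs
  imports "HOL-Library.Extended_Nat"
begin

section \<open>Crystals\<close>

text \<open>
  The operators are indexed by labels: \<open>Op i\<close> is the index \<open>i \<in> {0, ..., n - 1}\<close> and
  \<open>Bar1\<close> is the index \<open>1\<close> with a bar.  The auxiliary element \<open>0\<close> is \<open>None\<close>.
  A weight in \<open>\<int>^n\<close> is a function \<open>nat \<Rightarrow> int\<close> that vanishes outside \<open>{1..n}\<close>.
  Operators with labels not belonging to rank \<open>n\<close>, and values outside the
  carrier, carry no meaning and are never constrained.
\<close>

datatype label = Op nat | Bar1

record 'b crystal =
  elts :: "'b set"
  wt :: "'b \<Rightarrow> nat \<Rightarrow> int"
  eop :: "label \<Rightarrow> 'b \<Rightarrow> 'b option"
  fop :: "label \<Rightarrow> 'b \<Rightarrow> 'b option"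

definition unit_wt :: "nat \<Rightarrow> nat \<Rightarrow> int" where
  "unit_wt i = (\<lambda>k. if k = i then 1 else 0)"

definition lift :: "('b \<Rightarrow> 'b option) \<Rightarrow> 'b option \<Rightarrow> 'b option" where
  "lift g x = Option.bind x g"

definition string_length :: "('b \<Rightarrow> 'b option) \<Rightarrow> 'b \<Rightarrow> enat" where
  "string_length g b = (SUP k\<in>{k. (lift g ^^ k) (Some b) \<noteq> None}. enat k)"

definition eps :: "'b crystal \<Rightarrow> label \<Rightarrow> 'b \<Rightarrow> enat" where
  "eps B i b = string_length (eop B i) b"

definition phi :: "'b crystal \<Rightarrow> label \<Rightarrow> 'b \<Rightarrow> enat" where
  "phi B i b = string_length (fop B i) b"

definition commuting_on :: "'b set \<Rightarrow> ('b \<Rightarrow> 'b option) \<Rightarrow> ('b \<Rightarrow> 'b option) \<Rightarrow> bool" where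
  "commuting_on X g h \<longleftrightarrow> (\<forall>b\<in>X. lift g (h b) = lift h (g b))"

locale gl_crystal =
  fixes n :: nat and B :: "'b crystal"
  assumes nonempty: "elts B \<noteq> {}"
    and wt_support: "b \<in> elts B \<Longrightarrow> k \<notin> {1..n} \<Longrightarrow> wt B b k = 0"
    and eop_closed: "b \<in> elts B \<Longrightarrow> i \<in> {1..<n} \<Longrightarrow> eop B (Op i) b = Some c \<Longrightarrow> c \<in> elts B"
    and fop_closed: "b \<in> elts B \<Longrightarrow> i \<in> {1..<n} \<Longrightarrow> fop B (Op i) b = Some c \<Longrightarrow> c \<in> elts B"
    and S1_inverse: "b \<in> elts B \<Longrightarrow> c \<in> elts B \<Longrightarrow> i \<in> {1..<n} \<Longrightarrow>
      eop B (Op i) b = Some c \<longleftrightarrow> fop B (Op i) c = Some b"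
    and S1_wt: "b \<in> elts B \<Longrightarrow> c \<in> elts B \<Longrightarrow> i \<in> {1..<n} \<Longrightarrow> eop B (Op i) b = Some c \<Longrightarrow>
      wt B c k - wt B b k = unit_wt i k - unit_wt (Suc i) k"
    and S2_finite: "b \<in> elts B \<Longrightarrow> i \<in> {1..<n} \<Longrightarrow> eps B (Op i) b \<noteq> \<infinity> \<and> phi B (Op i) b \<noteq> \<infinity>"
    and S2_wt: "b \<in> elts B \<Longrightarrow> i \<in> {1..<n} \<Longrightarrow>
      int (the_enat (phi B (Op i) b)) - int (the_enat (eps B (Op i) b)) = wt B b i - wt B b (Suc i)"

text \<open>For \<open>n = 1\<close> the axioms on \<open>Bar1\<close> are void: only a nonempty set with a
  nonnegative weight map remains.\<close>

locale q_crystal = gl_crystal n B for n :: nat and B :: "'b crystal" +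
  assumes wt_nonneg: "b \<in> elts B \<Longrightarrow> wt B b k \<ge> 0"
    and ebar1_closed: "n \<ge> 2 \<Longrightarrow> b \<in> elts B \<Longrightarrow> eop B Bar1 b = Some c \<Longrightarrow> c \<in> elts B"
    and fbar1_closed: "n \<ge> 2 \<Longrightarrow> b \<in> elts B \<Longrightarrow> fop B Bar1 b = Some c \<Longrightarrow> c \<in> elts B"
    and P1_inverse: "n \<ge> 2 \<Longrightarrow> b \<in> elts B \<Longrightarrow> c \<in> elts B \<Longrightarrow>
      eop B Bar1 b = Some c \<longleftrightarrow> fop B Bar1 c = Some b"
    and P1_wt: "n \<ge> 2 \<Longrightarrow> b \<in> elts B \<Longrightarrow> c \<in> elts B \<Longrightarrow> eop B Bar1 b = Some c \<Longrightarrow>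
      wt B c k - wt B b k = unit_wt 1 k - unit_wt 2 k"
    and P1_strings: "n \<ge> 2 \<Longrightarrow> b \<in> elts B \<Longrightarrow> c \<in> elts B \<Longrightarrow> eop B Bar1 b = Some c \<Longrightarrow>
      i \<in> {3..<n} \<Longrightarrow> eps B (Op i) b = eps B (Op i) c \<and> phi B (Op i) b = phi B (Op i) c"
    and P2: "n \<ge> 2 \<Longrightarrow> i \<in> {3..<n} \<Longrightarrow> g \<in> {eop B (Op i), fop B (Op i)} \<Longrightarrow>
      h \<in> {eop B Bar1, fop B Bar1} \<Longrightarrow> commuting_on (elts B) g h"
    and P3: "n \<ge> 2 \<Longrightarrow> b \<in> elts B \<Longrightarrow>
      eps B Bar1 b + phi B Bar1 b = (if wt B b 1 = 0 \<and> wt B b 2 = 0 then 0 else 1)"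

locale qp_crystal = q_crystal n B for n :: nat and B :: "'b crystal" +
  assumes e0_closed: "b \<in> elts B \<Longrightarrow> eop B (Op 0) b = Some c \<Longrightarrow> c \<in> elts B"
    and f0_closed: "b \<in> elts B \<Longrightarrow> fop B (Op 0) b = Some c \<Longrightarrow> c \<in> elts B"
    and Q1_inverse: "b \<in> elts B \<Longrightarrow> c \<in> elts B \<Longrightarrow>
      eop B (Op 0) b = Some c \<longleftrightarrow> fop B (Op 0) c = Some b"
    and Q1_wt: "b \<in> elts B \<Longrightarrow> c \<in> elts B \<Longrightarrow> eop B (Op 0) b = Some c \<Longrightarrow> wt B b = wt B c"
    and Q1_strings: "b \<in> elts B \<Longrightarrow> c \<in> elts B \<Longrightarrow> eop B (Op 0) b = Some c \<Longrightarrow>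
      i \<in> {1..<n} \<Longrightarrow> eps B (Op i) b = eps B (Op i) c \<and> phi B (Op i) b = phi B (Op i) c"
    and Q1_strings_bar: "n \<ge> 2 \<Longrightarrow> b \<in> elts B \<Longrightarrow> c \<in> elts B \<Longrightarrow> eop B (Op 0) b = Some c \<Longrightarrow>
      eps B Bar1 b = eps B Bar1 c \<and> phi B Bar1 b = phi B Bar1 c"
    and Q2: "i \<in> {2..<n} \<Longrightarrow> g \<in> {eop B (Op i), fop B (Op i)} \<Longrightarrow>
      h \<in> {eop B (Op 0), fop B (Op 0)} \<Longrightarrow> commuting_on (elts B) g h"
    and Q3: "b \<in> elts B \<Longrightarrow>
      eps B (Op 0) b + phi B (Op 0) b = (if wt B b 1 = 0 then 0 else 1)"

section \<open>Crystal graphs, full subcrystals and isomorphisms\<close>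

definition labels :: "nat \<Rightarrow> label set" where
  "labels n = {Op i | i. i < n} \<union> (if n \<ge> 2 then {Bar1} else {})"

definition edges :: "nat \<Rightarrow> 'b crystal \<Rightarrow> ('b \<times> 'b) set" where
  "edges n B = {(b, c). b \<in> elts B \<and> c \<in> elts B \<and> (\<exists>i\<in>labels n. fop B i b = Some c)}"

definition weak_component :: "nat \<Rightarrow> 'b crystal \<Rightarrow> 'b \<Rightarrow> 'b set" where
  "weak_component n B b = {c \<in> elts B. (b, c) \<in> (edges n B \<union> (edges n B)\<inverse>)\<^sup>*}"

definition full_subcrystals :: "nat \<Rightarrow> 'b crystal \<Rightarrow> 'b crystal set" where
  "full_subcrystals n B = {B\<lparr>elts := weak_component n B b\<rparr> | b. b \<in> elts B}"

definition crystal_iso :: "nat \<Rightarrow> 'b crystal \<Rightarrow> 'c crystal \<Rightarrow> ('b \<Rightarrow> 'c) \<Rightarrow> bool" where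
  "crystal_iso n B C h \<longleftrightarrow> bij_betw h (elts B) (elts C) \<and>
    (\<forall>b\<in>elts B. wt C (h b) = wt B b) \<and>
    (\<forall>i\<in>labels n. \<forall>b\<in>elts B. \<forall>c\<in>elts B. fop B i b = Some c \<longleftrightarrow> fop C i (h b) = Some (h c))"

definition isomorphic :: "nat \<Rightarrow> 'b crystal \<Rightarrow> 'c crystal \<Rightarrow> bool" where
  "isomorphic n B C \<longleftrightarrow> (\<exists>h. crystal_iso n B C h)"

section \<open>Tensor products\<close>

definition opt_pair :: "'b option \<Rightarrow> 'c option \<Rightarrow> ('b \<times> 'c) option" (infixr \<open>\<otimes>\<^sub>o\<close> 70) where
  "x \<otimes>\<^sub>o y = Option.bind x (\<lambda>b. map_option (Pair b) y)"

fun tensor_e :: "'b crystal \<Rightarrow> 'c crystal \<Rightarrow> label \<Rightarrow> 'b \<times> 'c \<Rightarrow> ('b \<times> 'c) option" where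
  "tensor_e B C (Op i) (b, c) =
    (if i = 0 then
       (if wt B b 1 \<noteq> 0 then eop B (Op 0) b \<otimes>\<^sub>o Some c else Some b \<otimes>\<^sub>o eop C (Op 0) c)
     else
       (if eps B (Op i) b \<le> phi C (Op i) c then Some b \<otimes>\<^sub>o eop C (Op i) c
        else eop B (Op i) b \<otimes>\<^sub>o Some c))"
| "tensor_e B C Bar1 (b, c) =
    (if wt B b 1 = 0 \<and> wt B b 2 = 0 then Some b \<otimes>\<^sub>o eop C Bar1 c
     else if wt B b 1 = 0 \<and> lift (fop B (Op 0)) (eop B Bar1 b) \<noteq> None \<and> eop C (Op 0) c \<noteq> None
       then lift (fop B (Op 0)) (eop B Bar1 b) \<otimes>\<^sub>o eop C (Op 0) c
     else if wt B b 1 = 0 \<and> lift (eop B (Op 0)) (eop B Bar1 b) \<noteq> None \<and> fop C (Op 0) c \<noteq> None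
       then lift (eop B (Op 0)) (eop B Bar1 b) \<otimes>\<^sub>o fop C (Op 0) c
     else eop B Bar1 b \<otimes>\<^sub>o Some c)"

fun tensor_f :: "'b crystal \<Rightarrow> 'c crystal \<Rightarrow> label \<Rightarrow> 'b \<times> 'c \<Rightarrow> ('b \<times> 'c) option" where
  "tensor_f B C (Op i) (b, c) =
    (if i = 0 then
       (if wt B b 1 \<noteq> 0 then fop B (Op 0) b \<otimes>\<^sub>o Some c else Some b \<otimes>\<^sub>o fop C (Op 0) c)
     else
       (if eps B (Op i) b < phi C (Op i) c then Some b \<otimes>\<^sub>o fop C (Op i) c
        else fop B (Op i) b \<otimes>\<^sub>o Some c))"
| "tensor_f B C Bar1 (b, c) =
    (if wt B b 1 = 0 \<and> wt B b 2 = 0 then Some b \<otimes>\<^sub>o fop C Bar1 c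
     else if wt B b 1 = 1 \<and> lift (fop B Bar1) (fop B (Op 0) b) \<noteq> None \<and> eop C (Op 0) c \<noteq> None
       then lift (fop B Bar1) (fop B (Op 0) b) \<otimes>\<^sub>o eop C (Op 0) c
     else if wt B b 1 = 1 \<and> lift (fop B Bar1) (eop B (Op 0) b) \<noteq> None \<and> fop C (Op 0) c \<noteq> None
       then lift (fop B Bar1) (eop B (Op 0) b) \<otimes>\<^sub>o fop C (Op 0) c
     else fop B Bar1 b \<otimes>\<^sub>o Some c)"

definition tensor :: "'b crystal \<Rightarrow> 'c crystal \<Rightarrow> ('b \<times> 'c) crystal" where
  "tensor B C = \<lparr>elts = elts B \<times> elts C,
    wt = (\<lambda>(b, c) k. wt B b k + wt C c k),
    eop = tensor_e B C,
    fop = tensor_f B C\<rparr>"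

section \<open>The standard crystal, its tensor powers, and normality\<close>

text \<open>\<open>Prim i\<close> is the primed box.\<close>

datatype letter = Box nat | Prim nat

fun std_wt :: "letter \<Rightarrow> nat \<Rightarrow> int" where
  "std_wt (Box i) = unit_wt i"
| "std_wt (Prim i) = unit_wt i"

fun std_f :: "nat \<Rightarrow> label \<Rightarrow> letter \<Rightarrow> letter option" where
  "std_f n (Op i) (Box j) =
    (if i = 0 then (if j = 1 then Some (Prim 1) else None)
     else if j = i \<and> i < n then Some (Box (Suc i)) else None)"
| "std_f n (Op i) (Prim j) =
    (if i \<noteq> 0 \<and> j = i \<and> i < n then Some (Prim (Suc i)) else None)"
| "std_f n Bar1 (Box j) = (if j = 1 \<and> n \<ge> 2 then Some (Box 2) else None)"
| "std_f n Bar1 (Prim j) = (if j = 1 \<and> n \<ge> 2 then Some (Prim 2) else None)"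

fun std_e :: "nat \<Rightarrow> label \<Rightarrow> letter \<Rightarrow> letter option" where
  "std_e n (Op i) (Box j) =
    (if i \<noteq> 0 \<and> j = Suc i \<and> i < n then Some (Box i) else None)"
| "std_e n (Op i) (Prim j) =
    (if i = 0 then (if j = 1 then Some (Box 1) else None)
     else if j = Suc i \<and> i < n then Some (Prim i) else None)"
| "std_e n Bar1 (Box j) = (if j = 2 \<and> n \<ge> 2 then Some (Box 1) else None)"
| "std_e n Bar1 (Prim j) = (if j = 2 \<and> n \<ge> 2 then Some (Prim 1) else None)"

definition std_crystal :: "nat \<Rightarrow> letter crystal" where
  "std_crystal n = \<lparr>elts = Box ` {1..n} \<union> Prim ` {1..n}, wt = std_wt, eop = std_e n, fop = std_f n\<rparr>"

lemma std_e_iff_std_f: "std_e n i b = Some c \<longleftrightarrow> std_f n i c = Some b"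
  by (cases i; cases b; cases c) auto

text \<open>
  The \<open>m\<close>-th tensor power lives on words of length \<open>m\<close>: the word \<open>b # w\<close> stands for
  the tensor \<open>b \<otimes> w\<close>, and the empty word is the element of the one-element crystal of weight 0.
\<close>

fun tensor_power :: "nat \<Rightarrow> nat \<Rightarrow> letter list crystal" where
  "tensor_power n 0 =
    \<lparr>elts = {[]}, wt = (\<lambda>_ _. 0), eop = (\<lambda>_ _. None), fop = (\<lambda>_ _. None)\<rparr>"
| "tensor_power n (Suc m) =
    (let T = tensor (std_crystal n) (tensor_power n m) in
     \<lparr>elts = (\<lambda>(b, w). b # w) ` elts T,
      wt = (\<lambda>w. wt T (hd w, tl w)),
      eop = (\<lambda>i w. map_option (\<lambda>(b, w). b # w) (eop T i (hd w, tl w))),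
      fop = (\<lambda>i w. map_option (\<lambda>(b, w). b # w) (fop T i (hd w, tl w)))\<rparr>)"

definition normal_qp_crystal :: "nat \<Rightarrow> 'b crystal \<Rightarrow> bool" where
  "normal_qp_crystal n B \<longleftrightarrow> qp_crystal n B \<and>
    (\<forall>X\<in>full_subcrystals n B. \<exists>m. \<exists>Y\<in>full_subcrystals n (tensor_power n m). isomorphic n X Y)"

section \<open>Highest and lowest weight elements\<close>

text \<open>From here on operators are maps on \<open>B \<squnion> {0}\<close>, i.e. on \<open>'b option\<close>.\<close>

definition sigma :: "'b crystal \<Rightarrow> nat \<Rightarrow> 'b option \<Rightarrow> 'b option" where
  "sigma B i x = Option.bind x (\<lambda>b.
    let k = int (the_enat (phi B (Op i) b)) - int (the_enat (eps B (Op i) b)) in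
    if k \<ge> 0 then (lift (fop B (Op i)) ^^ nat k) (Some b)
    else (lift (eop B (Op i)) ^^ nat (- k)) (Some b))"

text \<open>The composition of the \<open>\<sigma>\<^sub>i\<close> over a word, the last letter of the word acting first.\<close>

definition sigma_word :: "'b crystal \<Rightarrow> nat list \<Rightarrow> 'b option \<Rightarrow> 'b option" where
  "sigma_word B is x = foldr (sigma B) is x"

text \<open>\<open>(1)(2,1)(3,2,1)...(n-1,...,2,1)\<close> and \<open>(0)(1,0)(2,1,0)...(n-1,...,1,0)\<close>.\<close>

definition word_w0 :: "nat \<Rightarrow> nat list" where
  "word_w0 n = concat (map (\<lambda>j. rev [1..<Suc j]) [1..<n])"

definition word_w0_plus :: "nat \<Rightarrow> nat list" where
  "word_w0_plus n = concat (map (\<lambda>j. rev [0..<Suc j]) [0..<n])"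

definition sigma_w0 :: "nat \<Rightarrow> 'b crystal \<Rightarrow> 'b option \<Rightarrow> 'b option" where
  "sigma_w0 n B = sigma_word B (word_w0 n)"

definition sigma_w0_plus :: "nat \<Rightarrow> 'b crystal \<Rightarrow> 'b option \<Rightarrow> 'b option" where
  "sigma_w0_plus n B = sigma_word B (word_w0_plus n)"

text \<open>\<open>e_bar B i\<close> is only meaningful for \<open>i \<ge> 1\<close>.\<close>

fun e_bar :: "'b crystal \<Rightarrow> nat \<Rightarrow> 'b option \<Rightarrow> 'b option" where
  "e_bar B 0 x = None"
| "e_bar B (Suc 0) x = lift (eop B Bar1) x"
| "e_bar B (Suc (Suc i)) x =
    sigma B (Suc i) (sigma B (Suc (Suc i)) (e_bar B (Suc i)
      (sigma B (Suc (Suc i)) (sigma B (Suc i) x))))"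

definition f_bar' :: "nat \<Rightarrow> 'b crystal \<Rightarrow> nat \<Rightarrow> 'b option \<Rightarrow> 'b option" where
  "f_bar' n B i x =
    sigma_w0 n B (e_bar B (n - i) (inv_into (insert None (Some ` elts B)) (sigma_w0 n B) x))"

definition e0_conj :: "'b crystal \<Rightarrow> nat \<Rightarrow> 'b option \<Rightarrow> 'b option" where
  "e0_conj B i x = sigma_word B (rev [1..<i]) (lift (eop B (Op 0)) (sigma_word B [1..<i] x))"

definition f0_conj :: "'b crystal \<Rightarrow> nat \<Rightarrow> 'b option \<Rightarrow> 'b option" where
  "f0_conj B i x = sigma_word B (rev [1..<i]) (lift (fop B (Op 0)) (sigma_word B [1..<i] x))"

definition highest_weight_element :: "nat \<Rightarrow> 'b crystal \<Rightarrow> 'b \<Rightarrow> bool" where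
  "highest_weight_element n B b \<longleftrightarrow> b \<in> elts B \<and>
    (\<forall>i\<in>{1..<n}. eop B (Op i) b = None \<and> e_bar B i (Some b) = None) \<and>
    (\<forall>i\<in>{1..n}. e0_conj B i (Some b) = None)"

definition lowest_weight_element :: "nat \<Rightarrow> 'b crystal \<Rightarrow> 'b \<Rightarrow> bool" where
  "lowest_weight_element n B b \<longleftrightarrow> b \<in> elts B \<and>
    (\<forall>i\<in>{1..<n}. fop B (Op i) b = None \<and> f_bar' n B i (Some b) = None) \<and>
    (\<forall>i\<in>{1..n}. f0_conj B i (Some b) = None)"

end

theory Submission
  imports Defs "HOL-Library.Multiset" "HOL-Combinatorics.Transposition"
begin

text \<open>A component of a normal crystal consists of words in primed and unprimed letters. Such a word
is the same as a word of numbers together with a mark on every primed position, and most of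
the structure sees only one of the two. For \<open>i \<ge> 1\<close> the operators \<open>e\<^sub>i\<close>, \<open>f\<^sub>i\<close>, \<open>\<sigma>\<^sub>i\<close> move
letters and leave the marks in place; \<open>e\<^sub>0\<close>, \<open>f\<^sub>0\<close>, \<open>\<sigma>\<^sub>0\<close> change nothing but the mark at the first
letter 1; and whether the barred \<open>e\<^sub>1\<close> gives zero depends on the letters alone: it does unless
the first letter among 1, 2 is a 2. So being a lowest or a highest weight element splits into a
condition on the word of numbers and a condition on certain marks.

Words of numbers. Call a word extremal if the Euclidean norm of its content is maximal in its
component. Highest and lowest weight words are extremal, each \<open>\<sigma>\<^sub>i\<close> (\<open>i \<ge> 1\<close>) keeps extremality and
swaps two entries of the content, and within one component an extremal word is determined by
its content (\<open>extremal_unique\<close>). Hence two products of reflections agree on an extremal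
word as soon as they permute the content in the same way. In particular the product along the longest word reverses the content and
exchanges lowest with highest weight words. All this rests on the fact that a component has only
one highest weight word. The reason is an invariant: let a Hecke generator
send a word to the top of its \<open>i\<close>-string. These maps are idempotent, commute when far apart and
satisfy the braid relation (\<open>string_top_braid\<close>), so their product along the longest word
absorbs every single one; it is therefore constant on components and fixes highest weight words.
Reversal of words turns this into the uniqueness of lowest weight words.

Marks. By sorting the contents of the letters \<open>2, \<dots>, n\<close> one sees that two extremal words of one
component with equally many letters 1 have them at the same positions (\<open>extremal_ones\<close>). So the
position of the first 1 is a function of the number of ones. For an extremal word with
content \<open>\<mu>\<close> the zero operators conjugated to index \<open>i\<close> look at the mark at the position that belongs to
\<open>\<mu>\<^sub>i\<close>, and the product \<open>\<sigma>\<close> of the claim flips the marks at the positions that belong to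
\<open>\<mu>\<^sub>1, \<dots>, \<mu>\<^sub>n\<close>, one after the other (\<open>foldr_reflect_marked_w0_plus\<close>). The lowest weight condition
wants all these marks set and the highest weight condition wants them all clear. These are
exchanged if these positions are distinct, and this is what the barred operators guarantee: if
they vanish on a dominant extremal word, then the positions increase strictly
with the index (\<open>first_pos_increasing\<close>).\<close>

section \<open>Signatures of words\<close>

text \<open>Reading from the right, a letter \<open>b\<close> is matched with a free \<open>a\<close> to its right if there is one; this
is the cancellation that the tensor product rule performs for \<open>a = i\<close>, \<open>b = i + 1\<close>. Letters are
arbitrary here because reversal of a word exchanges the roles of \<open>a\<close> and \<open>b\<close>. The free letters
form a word \<open>a \<dots> a b \<dots> b\<close>, whose two parts are counted by \<open>phi_word\<close> and \<open>eps_word\<close>; the operators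
move the border between the parts. A call of \<open>lower\<close> is only meaningful when a free \<open>a\<close> exists.\<close>

primrec phi_word :: "'a \<Rightarrow> 'a \<Rightarrow> 'a list \<Rightarrow> nat" where
  "phi_word a b [] = 0"
| "phi_word a b (x # u) = (if x = a then Suc (phi_word a b u) else if x = b then phi_word a b u - 1 else phi_word a b u)"

primrec eps_word :: "'a \<Rightarrow> 'a \<Rightarrow> 'a list \<Rightarrow> nat" where
  "eps_word a b [] = 0"
| "eps_word a b (x # u) = (if x = b \<and> phi_word a b u = 0 then Suc (eps_word a b u) else eps_word a b u)"

primrec lower :: "'a \<Rightarrow> 'a \<Rightarrow> 'a list \<Rightarrow> 'a list" where
  "lower a b [] = []"
| "lower a b (x # u) = (if x = a \<and> phi_word a b u = 0 then b # u else x # lower a b u)"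

primrec raise :: "'a \<Rightarrow> 'a \<Rightarrow> 'a list \<Rightarrow> 'a list" where
  "raise a b [] = []"
| "raise a b (x # u) = (if x = b \<and> phi_word a b u = 0 then a # u else x # raise a b u)"

primrec string_top :: "'a \<Rightarrow> 'a \<Rightarrow> 'a list \<Rightarrow> 'a list" where
  "string_top a b [] = []"
| "string_top a b (x # u) = (if x = b \<and> phi_word a b u = 0 then a else x) # string_top a b u"

lemma phi_eps_count: "a \<noteq> b \<Longrightarrow> phi_word a b u + count_list u b = eps_word a b u + count_list u a"
  by (induction u) auto

lemma lower_step:
  assumes "a \<noteq> b" "0 < phi_word a b u"
  shows "Suc (phi_word a b (lower a b u)) = phi_word a b u \<and> eps_word a b (lower a b u) = Suc (eps_word a b u)
    \<and> raise a b (lower a b u) = u"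
  using assms(2)
proof (induction u)
  case (Cons x u)
  then show ?case using assms(1) by (cases "phi_word a b u = 0"; cases "x = b") (auto split: if_splits)
qed simp

lemma raise_step:
  assumes "a \<noteq> b" "0 < eps_word a b u"
  shows "phi_word a b (raise a b u) = Suc (phi_word a b u) \<and> Suc (eps_word a b (raise a b u)) = eps_word a b u
    \<and> lower a b (raise a b u) = u"
  using assms(2)
proof (induction u)
  case (Cons x u)
  then show ?case using assms(1) by (auto split: if_splits)
qed simp

lemma string_top_id: "eps_word a b u = 0 \<Longrightarrow> string_top a b u = u"
  by (induction u) (auto split: if_splits)

lemma string_top_facts:
  assumes "a \<noteq> b"
  shows "phi_word a b (string_top a b u) = phi_word a b u + eps_word a b u \<and> eps_word a b (string_top a b u) = 0"
  using assms by (induction u) auto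

lemma string_top_lower:
  assumes "a \<noteq> b" "0 < phi_word a b u"
  shows "string_top a b (lower a b u) = string_top a b u"
  using assms(2)
proof (induction u)
  case (Cons x u)
  have s: "0 < phi_word a b u \<Longrightarrow> Suc (phi_word a b (lower a b u)) = phi_word a b u" using lower_step[OF assms(1)] by blast
  show ?case using Cons s assms(1) by (cases "phi_word a b u"; cases "x = b") auto
qed simp

lemma string_top_commute:
  assumes "a \<noteq> c" "a \<noteq> d" "b \<noteq> c" "b \<noteq> d" "a \<noteq> b" "c \<noteq> d"
  shows "string_top a b (string_top c d u) = string_top c d (string_top a b u)
    \<and> phi_word a b (string_top c d u) = phi_word a b u \<and> phi_word c d (string_top a b u) = phi_word c d u"
  using assms by (induction u) auto

text \<open>Both triple products are transducers that read the word from the right, and the state of each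
consists of three counts of free letters. The three equations between the states are the
tropical change of coordinates between the two reduced words of the longest permutation of
three letters. They are part of the induction because they force the two transducers to output the
same letter in every step.\<close>

lemma string_top_braid_states:
  assumes "a \<noteq> b" "a \<noteq> c" "b \<noteq> c"
  shows "string_top a b (string_top b c (string_top a b u)) = string_top b c (string_top a b (string_top b c u))
    \<and> phi_word b c u = phi_word b c (string_top a b u) + (phi_word a b (string_top b c (string_top a b u)) - phi_word a b u)
    \<and> phi_word a b (string_top b c u) = min (phi_word a b u) (phi_word a b (string_top b c (string_top a b u)))
    \<and> phi_word b c (string_top a b (string_top b c u)) =
        phi_word b c (string_top a b u) + (phi_word a b u - phi_word a b (string_top b c (string_top a b u)))"
proof (induction u)
  case (Cons x u)
  define A B C where "A = phi_word a b u" and "B = phi_word b c (string_top a b u)"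
    and "C = phi_word a b (string_top b c (string_top a b u))"
  define A' B' C' where "A' = phi_word b c u" and "B' = phi_word a b (string_top b c u)"
    and "C' = phi_word b c (string_top a b (string_top b c u))"
  note defs = A_def[symmetric] B_def[symmetric] C_def[symmetric]
    A'_def[symmetric] B'_def[symmetric] C'_def[symmetric]
  have same: "string_top a b (string_top b c (string_top a b u)) = string_top b c (string_top a b (string_top b c u))"
    and states: "A' = B + (C - A)" "B' = min A C" "C' = B + (A - C)"
    using Cons defs by simp_all
  consider "x = a" | "x = b" | "x = c" | "x \<noteq> a" "x \<noteq> b" "x \<noteq> c" by blast
  then show ?case
  proof cases
    case 1
    then show ?thesis using assms by (simp add: defs same) (simp add: states min_def)
  next
    case 2
    then show ?thesis using assms
      \<comment> \<open>The letter passes all operators at once; what remains is arithmetic in the counts.\<close>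
      apply (simp add: defs same split del: if_split)
      apply (simp only: states)
      apply (cases A; cases C; cases B)
             apply (simp_all add: defs states same min_def Suc_diff_le split: if_splits)
      done
  next
    case 3
    then show ?thesis using assms
      apply (simp add: defs same split del: if_split)
      apply (simp only: states)
      apply (cases A; cases C; cases B)
             apply (simp_all add: defs states same min_def Suc_diff_le split: if_splits)
      done
  next
    case 4
    then show ?thesis using assms by (simp add: defs same) (simp add: states)
  qed
qed simp

lemma string_top_braid:
  assumes "a \<noteq> b" "a \<noteq> c" "b \<noteq> c"
  shows "string_top a b (string_top b c (string_top a b u)) = string_top b c (string_top a b (string_top b c u))"
  using string_top_braid_states[OF assms] by blast

lemma string_top_idem: "a \<noteq> b \<Longrightarrow> string_top a b (string_top a b u) = string_top a b u"
  by (simp add: string_top_facts string_top_id)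

lemma string_top_raise: "a \<noteq> b \<Longrightarrow> 0 < eps_word a b u \<Longrightarrow> string_top a b (raise a b u) = string_top a b u"
  using raise_step[of a b u] string_top_lower[of a b "raise a b u"] by simp

lemma length_lower [simp]: "length (lower a b u) = length u" by (induction u) auto
lemma length_raise [simp]: "length (raise a b u) = length u" by (induction u) auto
lemma length_string_top [simp]: "length (string_top a b u) = length u" by (induction u) auto

section \<open>Hecke products along the longest word\<close>

lemma word_w0_Suc: "word_w0 (Suc k) = word_w0 k @ rev [1..<Suc k]"
  by (cases k) (simp_all add: word_w0_def)

lemma set_word_w0: "set (word_w0 n) \<subseteq> {1..<n}"
  by (auto simp: word_w0_def)

text \<open>The generators act as maps \<open>T i\<close> of an arbitrary type, so that the argument is the one for the
0-Hecke monoid of the symmetric group. Each block \<open>m, \<dots>, 1\<close> of the longest word either swallows a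
generator or passes it on to the shorter blocks with index lowered by one.\<close>

context
  fixes T :: "nat \<Rightarrow> 'c \<Rightarrow> 'c" and n :: nat
  assumes idem: "\<And>i x. 1 \<le> i \<Longrightarrow> i < n \<Longrightarrow> T i (T i x) = T i x"
    and braid: "\<And>i x. 1 \<le> i \<Longrightarrow> Suc i < n \<Longrightarrow>
      T i (T (Suc i) (T i x)) = T (Suc i) (T i (T (Suc i) x))"
    and comm: "\<And>i j x. 1 \<le> i \<Longrightarrow> Suc i < j \<Longrightarrow> j < n \<Longrightarrow> T i (T j x) = T j (T i x)"
begin

lemma hecke_commute_block:
  "Suc m < j \<Longrightarrow> j < n \<Longrightarrow> foldr T (rev [1..<Suc m]) (T j x) = T j (foldr T (rev [1..<Suc m]) x)"
  by (induction m) (auto simp: comm)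

lemma hecke_slide:
  "1 \<le> i \<Longrightarrow> i < m \<Longrightarrow> m < n \<Longrightarrow>
    foldr T (rev [1..<Suc m]) (T (Suc i) x) = T i (foldr T (rev [1..<Suc m]) x)"
proof (induction m)
  case (Suc m)
  show ?case
  proof (cases "i < m")
    case True
    then show ?thesis using Suc comm[of i "Suc m"] by simp
  next
    case False
    then have "i = m" using Suc by simp
    then obtain l where l: "m = Suc l" using Suc.prems by (cases m) auto
    have "foldr T (rev [1..<Suc l]) (T (Suc m) x) = T (Suc m) (foldr T (rev [1..<Suc l]) x)"
      using l Suc.prems by (intro hecke_commute_block) auto
    then show ?thesis using l \<open>i = m\<close> Suc.prems by (simp add: braid)
  qed
qed simp

lemma hecke_absorb:
  "m \<le> n \<Longrightarrow> 1 \<le> i \<Longrightarrow> i < m \<Longrightarrow> foldr T (word_w0 m) (T i x) = foldr T (word_w0 m) x"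
proof (induction m arbitrary: i x)
  case (Suc m)
  show ?case
  proof (cases "i = 1")
    case True
    then have "[1..<Suc m] = 1 # [2..<Suc m]"
      using Suc.prems by (simp add: upt_conv_Cons numeral_2_eq_2)
    then show ?thesis using True Suc.prems by (simp add: word_w0_Suc idem del: upt_Suc)
  next
    case False
    then obtain k where k: "i = Suc k" "1 \<le> k" using Suc.prems by (cases i) auto
    then have "foldr T (rev [1..<Suc m]) (T i x) = T k (foldr T (rev [1..<Suc m]) x)"
      using hecke_slide[of k m x] Suc.prems by simp
    then show ?thesis using Suc k by (simp add: word_w0_Suc del: upt_Suc)
  qed
qed simp

end

text \<open>The map \<open>g\<close> lists the letters in the order in which they are to be raised: the identity leads
towards highest weight words, and a decreasing list, applied to reversed words, towards lowest
weight words.\<close>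

definition raise_fully :: "(nat \<Rightarrow> 'a) \<Rightarrow> nat \<Rightarrow> 'a list \<Rightarrow> 'a list" where
  "raise_fully g n = foldr (\<lambda>i. string_top (g i) (g (Suc i))) (word_w0 n)"

lemma raise_fully_absorb:
  assumes "inj_on g {1..n}" "1 \<le> i" "i < n"
  shows "raise_fully g n (string_top (g i) (g (Suc i)) u) = raise_fully g n u"
proof -
  have d: "g i = g j \<longleftrightarrow> i = j" if "i \<in> {1..n}" "j \<in> {1..n}" for i j
    using that inj_on_eq_iff[OF assms(1)] by blast
  show ?thesis unfolding raise_fully_def
    by (rule hecke_absorb[where n = n])
      (use assms in \<open>auto intro!: string_top_idem string_top_braid string_top_commute[THEN conjunct1] simp: d\<close>)
qed

lemma raise_fully_lower:
  assumes "inj_on g {1..n}" "1 \<le> i" "i < n" "0 < phi_word (g i) (g (Suc i)) u"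
  shows "raise_fully g n (lower (g i) (g (Suc i)) u) = raise_fully g n u"
proof -
  have "g i \<noteq> g (Suc i)" using assms(1-3) by (auto dest: inj_onD)
  then show ?thesis using raise_fully_absorb[OF assms(1-3)] string_top_lower assms(4) by metis
qed

lemma raise_fully_raise:
  assumes "inj_on g {1..n}" "1 \<le> i" "i < n" "0 < eps_word (g i) (g (Suc i)) u"
  shows "raise_fully g n (raise (g i) (g (Suc i)) u) = raise_fully g n u"
proof -
  have "g i \<noteq> g (Suc i)" using assms(1-3) by (auto dest: inj_onD)
  then show ?thesis using raise_fully_absorb[OF assms(1-3)] string_top_raise assms(4) by metis
qed

lemma raise_fully_fix:
  assumes "\<And>i. 1 \<le> i \<Longrightarrow> i < n \<Longrightarrow> eps_word (g i) (g (Suc i)) u = 0"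
  shows "raise_fully g n u = u"
proof -
  have "foldr (\<lambda>i. string_top (g i) (g (Suc i))) is u = u" if "set is \<subseteq> {1..<n}" for "is"
    using that by (induction "is") (auto simp: assms string_top_id)
  then show ?thesis using set_word_w0 by (simp add: raise_fully_def)
qed

lemma length_raise_fully [simp]: "length (raise_fully g n u) = length u"
proof -
  have "length (foldr (\<lambda>i. string_top (g i) (g (Suc i))) is u) = length u" for "is"
    by (induction "is") auto
  then show ?thesis by (simp add: raise_fully_def)
qed

section \<open>Reversal of words\<close>

lemma phi_eps_snoc:
  assumes "a \<noteq> b"
  shows "phi_word a b (u @ [x]) = (if x = a \<and> eps_word a b u = 0 then Suc (phi_word a b u) else phi_word a b u)
    \<and> eps_word a b (u @ [x]) = (if x = a then eps_word a b u - 1 else if x = b then Suc (eps_word a b u) else eps_word a b u)"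
  using assms by (induction u) auto

lemma raise_snoc:
  assumes "a \<noteq> b" "0 < eps_word a b (u @ [x])"
  shows "raise a b (u @ [x]) = (if x = b \<and> eps_word a b u = 0 then u @ [a] else raise a b u @ [x])"
  using assms(2)
proof (induction u)
  case (Cons y u)
  then show ?case using assms(1) by (auto simp: phi_eps_snoc[OF assms(1)] split: if_splits)
qed (use assms in \<open>auto split: if_splits\<close>)

lemma phi_eps_rev:
  assumes "a \<noteq> b"
  shows "phi_word b a (rev u) = eps_word a b u \<and> eps_word b a (rev u) = phi_word a b u"
  using assms by (induction u) (auto simp: phi_eps_snoc)

text \<open>Reversal turns the matching of \<open>b\<close> with a later \<open>a\<close> into the matching of \<open>a\<close> with a later \<open>b\<close>.\<close>

lemma lower_rev:
  assumes "a \<noteq> b" "0 < phi_word a b u"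
  shows "rev (lower a b u) = raise b a (rev u)"
  using assms(2)
proof (induction u)
  case (Cons x u)
  have "0 < eps_word b a (rev u @ [x])"
    using Cons.prems phi_eps_rev[OF assms(1), of "x # u"] by simp
  then show ?case using assms(1) Cons
    by (auto simp: raise_snoc phi_eps_rev[of a b] split: if_splits)
qed simp

section \<open>Uniqueness of highest and lowest weight words\<close>

text \<open>A pair of invariants under all \<open>e\<^sub>i\<close>, \<open>f\<^sub>i\<close> replaces connectedness: words of one component have the
same class. The first entry pins down highest weight words, the second one lowest weight words.\<close>

definition crystal_class :: "nat \<Rightarrow> nat list \<Rightarrow> nat list \<times> nat list" where
  "crystal_class n u = (raise_fully (\<lambda>k. k) n u, raise_fully (\<lambda>k. Suc n - k) n (rev u))"

lemma crystal_class_lower: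
  assumes "1 \<le> i" "i < n" "0 < phi_word i (Suc i) u"
  shows "crystal_class n (lower i (Suc i) u) = crystal_class n u"
proof -
  have inj: "inj_on (\<lambda>k. Suc n - k) {1..n}"
    by (rule inj_onI) auto
  have "raise_fully (\<lambda>k. Suc n - k) n (raise (Suc i) i (rev u)) = raise_fully (\<lambda>k. Suc n - k) n (rev u)"
    using raise_fully_raise[OF inj, of "n - i" "rev u"] assms phi_eps_rev[of i "Suc i" u]
    by (simp add: Suc_diff_le)
  moreover have "raise_fully (\<lambda>k. k) n (lower i (Suc i) u) = raise_fully (\<lambda>k. k) n u"
    using raise_fully_lower[of "\<lambda>k. k" n i u] assms by (simp add: inj_on_def)
  ultimately show ?thesis using assms(3) by (simp add: crystal_class_def lower_rev)
qed

lemma crystal_class_raise: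
  assumes "1 \<le> i" "i < n" "0 < eps_word i (Suc i) u"
  shows "crystal_class n (raise i (Suc i) u) = crystal_class n u"
  using crystal_class_lower[OF assms(1,2), of "raise i (Suc i) u"] raise_step[of i "Suc i" u] assms(3) by simp

lemma crystal_class_length: "crystal_class n u = crystal_class n v \<Longrightarrow> length u = length v"
  by (metis crystal_class_def fst_conv length_raise_fully)

lemma crystal_class_highest_unique:
  assumes "crystal_class n u = crystal_class n v"
    and "\<And>i. 1 \<le> i \<Longrightarrow> i < n \<Longrightarrow> eps_word i (Suc i) u = 0"
    and "\<And>i. 1 \<le> i \<Longrightarrow> i < n \<Longrightarrow> eps_word i (Suc i) v = 0"
  shows "u = v"
  using assms raise_fully_fix[of n "\<lambda>k. k" u] raise_fully_fix[of n "\<lambda>k. k" v] by (simp add: crystal_class_def)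

lemma crystal_class_lowest_unique:
  assumes "crystal_class n u = crystal_class n v"
    and "\<And>i. 1 \<le> i \<Longrightarrow> i < n \<Longrightarrow> phi_word i (Suc i) u = 0"
    and "\<And>i. 1 \<le> i \<Longrightarrow> i < n \<Longrightarrow> phi_word i (Suc i) v = 0"
  shows "u = v"
proof -
  have "raise_fully (\<lambda>k. Suc n - k) n (rev w) = rev w"
    if "\<And>i. 1 \<le> i \<Longrightarrow> i < n \<Longrightarrow> phi_word i (Suc i) w = 0" for w :: "nat list"
  proof (rule raise_fully_fix)
    fix i assume "1 \<le> i" "i < n"
    then show "eps_word (Suc n - i) (Suc n - Suc i) (rev w) = 0"
      using that[of "n - i"] phi_eps_rev[of "n - i" "Suc (n - i)" w] by (simp add: Suc_diff_le)
  qed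
  then have "rev u = rev v" using assms by (metis crystal_class_def snd_conv)
  then show ?thesis by simp
qed

section \<open>Reflections\<close>

lemma count_lower:
  assumes "a \<noteq> b" "0 < phi_word a b u"
  shows "Suc (count_list (lower a b u) a) = count_list u a"
    and "count_list (lower a b u) b = Suc (count_list u b)"
    and "k \<noteq> a \<Longrightarrow> k \<noteq> b \<Longrightarrow> count_list (lower a b u) k = count_list u k"
proof -
  have "Suc (count_list (lower a b u) a) = count_list u a \<and>
    count_list (lower a b u) b = Suc (count_list u b) \<and>
    (k \<noteq> a \<longrightarrow> k \<noteq> b \<longrightarrow> count_list (lower a b u) k = count_list u k)"
    using assms(2)
  proof (induction u)
    case (Cons x u)
    then show ?case using assms(1) by (cases "phi_word a b u = 0") (auto split: if_splits)
  qed simp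
  then show "Suc (count_list (lower a b u) a) = count_list u a"
    and "count_list (lower a b u) b = Suc (count_list u b)"
    and "k \<noteq> a \<Longrightarrow> k \<noteq> b \<Longrightarrow> count_list (lower a b u) k = count_list u k" by auto
qed

lemma lower_places:
  "map (\<lambda>x. x = a \<or> x = b) (lower a b u) = map (\<lambda>x. x = a \<or> x = b) u"
  "c \<noteq> a \<Longrightarrow> c \<noteq> b \<Longrightarrow> map (\<lambda>x. x = c) (lower a b u) = map (\<lambda>x. x = c) u"
  by (induction u) auto

lemma raise_places:
  "map (\<lambda>x. x = a \<or> x = b) (raise a b u) = map (\<lambda>x. x = a \<or> x = b) u"
  "c \<noteq> a \<Longrightarrow> c \<noteq> b \<Longrightarrow> map (\<lambda>x. x = c) (raise a b u) = map (\<lambda>x. x = c) u"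
  by (induction u) auto

lemma lower_funpow:
  assumes "a \<noteq> b" "k \<le> phi_word a b u"
  shows "phi_word a b ((lower a b ^^ k) u) = phi_word a b u - k \<and> eps_word a b ((lower a b ^^ k) u) = eps_word a b u + k
    \<and> (raise a b ^^ k) ((lower a b ^^ k) u) = u"
  using assms(2)
proof (induction k)
  case (Suc k)
  define v where "v = (lower a b ^^ k) u"
  have v: "phi_word a b v = phi_word a b u - k" "eps_word a b v = eps_word a b u + k" "(raise a b ^^ k) v = u" "0 < phi_word a b v"
    using Suc by (auto simp: v_def)
  have "(raise a b ^^ Suc k) (lower a b v) = (raise a b ^^ k) (raise a b (lower a b v))"
    by (simp only: funpow_Suc_right o_apply)
  then show ?case using v lower_step[OF assms(1) v(4)] by (auto simp: v_def[symmetric])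
qed simp

lemma raise_funpow:
  assumes "a \<noteq> b" "k \<le> eps_word a b u"
  shows "phi_word a b ((raise a b ^^ k) u) = phi_word a b u + k \<and> eps_word a b ((raise a b ^^ k) u) = eps_word a b u - k
    \<and> (lower a b ^^ k) ((raise a b ^^ k) u) = u"
  using assms(2)
proof (induction k)
  case (Suc k)
  define v where "v = (raise a b ^^ k) u"
  have v: "phi_word a b v = phi_word a b u + k" "eps_word a b v = eps_word a b u - k" "(lower a b ^^ k) v = u" "0 < eps_word a b v"
    using Suc by (auto simp: v_def)
  have "(lower a b ^^ Suc k) (raise a b v) = (lower a b ^^ k) (lower a b (raise a b v))"
    by (simp only: funpow_Suc_right o_apply)
  then show ?case using v raise_step[OF assms(1) v(4)] by (auto simp: v_def[symmetric])
qed simp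

text \<open>This is \<open>\<sigma>\<^sub>i\<close> on words of numbers, for \<open>i \<ge> 1\<close>.\<close>

definition reflect :: "nat \<Rightarrow> nat list \<Rightarrow> nat list" where
  "reflect i u = (if eps_word i (Suc i) u \<le> phi_word i (Suc i) u
     then (lower i (Suc i) ^^ (phi_word i (Suc i) u - eps_word i (Suc i) u)) u
     else (raise i (Suc i) ^^ (eps_word i (Suc i) u - phi_word i (Suc i) u)) u)"

text \<open>A reflection is a chain of steps inside one \<open>i\<close>-string, so whatever single steps preserve is
preserved by it.\<close>

lemma reflect_invariant:
  assumes "\<And>v. 0 < phi_word i (Suc i) v \<Longrightarrow> P (lower i (Suc i) v) = P v"
    and "\<And>v. 0 < eps_word i (Suc i) v \<Longrightarrow> P (raise i (Suc i) v) = P v"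
  shows "P (reflect i u) = P u"
proof -
  have "P ((lower i (Suc i) ^^ k) u) = P u" if "k \<le> phi_word i (Suc i) u" for k
    using that
  proof (induction k)
    case (Suc k)
    then show ?case using assms(1) lower_funpow[of i "Suc i" k u] by simp
  qed simp
  moreover have "P ((raise i (Suc i) ^^ k) u) = P u" if "k \<le> eps_word i (Suc i) u" for k
    using that
  proof (induction k)
    case (Suc k)
    then show ?case using assms(2) raise_funpow[of i "Suc i" k u] by simp
  qed simp
  ultimately show ?thesis by (simp add: reflect_def)
qed

lemma phi_reflect [simp]: "phi_word i (Suc i) (reflect i u) = eps_word i (Suc i) u"
  and eps_reflect [simp]: "eps_word i (Suc i) (reflect i u) = phi_word i (Suc i) u"
  using lower_funpow[of i "Suc i" "phi_word i (Suc i) u - eps_word i (Suc i) u" u]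
    raise_funpow[of i "Suc i" "eps_word i (Suc i) u - phi_word i (Suc i) u" u]
  by (auto simp: reflect_def)

lemma reflect_reflect [simp]: "reflect i (reflect i u) = u"
proof (cases "eps_word i (Suc i) u = phi_word i (Suc i) u")
  case True
  then show ?thesis by (simp add: reflect_def)
next
  case False
  then show ?thesis
    using lower_funpow[of i "Suc i" "phi_word i (Suc i) u - eps_word i (Suc i) u" u]
      raise_funpow[of i "Suc i" "eps_word i (Suc i) u - phi_word i (Suc i) u" u]
    by (subst reflect_def, unfold phi_reflect eps_reflect) (auto simp: reflect_def)
qed

lemma length_reflect [simp]: "length (reflect i u) = length u"
  by (rule reflect_invariant) auto

lemma crystal_class_reflect: "1 \<le> i \<Longrightarrow> i < n \<Longrightarrow> crystal_class n (reflect i u) = crystal_class n u"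
  by (rule reflect_invariant) (auto simp: crystal_class_lower crystal_class_raise)

text \<open>Single steps exchange the letters \<open>i\<close> and \<open>i + 1\<close> only, hence fix the set of positions of these two
letters and the positions of each other letter.\<close>

lemma reflect_places:
  "map (\<lambda>x. x = i \<or> x = Suc i) (reflect i u) = map (\<lambda>x. x = i \<or> x = Suc i) u"
  "c \<noteq> i \<Longrightarrow> c \<noteq> Suc i \<Longrightarrow> map (\<lambda>x. x = c) (reflect i u) = map (\<lambda>x. x = c) u"
  by (rule reflect_invariant; simp add: lower_places raise_places)+

lemma count_list_places: "count_list u c = count_list (map (\<lambda>x. x = c) u) True"
  by (induction u) auto

lemma count_reflect: "count_list (reflect i u) k = count_list u (transpose i (Suc i) k)"
proof -
  have other: "count_list (reflect i u) c = count_list u c" if "c \<noteq> i" "c \<noteq> Suc i" for c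
    by (metis count_list_places reflect_places(2)[OF that])
  have sum: "count_list (reflect i u) i + count_list (reflect i u) (Suc i) = count_list u i + count_list u (Suc i)"
  proof (rule reflect_invariant)
    fix v assume "0 < phi_word i (Suc i) v"
    then show "count_list (lower i (Suc i) v) i + count_list (lower i (Suc i) v) (Suc i)
      = count_list v i + count_list v (Suc i)"
      using count_lower[of i "Suc i" v] by simp
  next
    fix v assume e: "0 < eps_word i (Suc i) v"
    then show "count_list (raise i (Suc i) v) i + count_list (raise i (Suc i) v) (Suc i)
      = count_list v i + count_list v (Suc i)"
      using count_lower[of i "Suc i" "raise i (Suc i) v"] raise_step[OF _ e] by simp
  qed
  moreover have "eps_word i (Suc i) u + count_list (reflect i u) (Suc i) = phi_word i (Suc i) u + count_list (reflect i u) i"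
    using phi_eps_count[of i "Suc i" "reflect i u"] by simp
  moreover have "phi_word i (Suc i) u + count_list u (Suc i) = eps_word i (Suc i) u + count_list u i"
    using phi_eps_count[of i "Suc i" u] by simp
  ultimately have "count_list (reflect i u) i = count_list u (Suc i)"
    "count_list (reflect i u) (Suc i) = count_list u i" by linarith+
  with other show ?thesis by (auto simp: transpose_def)
qed

section \<open>Extremal words\<close>

definition norm2 :: "nat \<Rightarrow> nat list \<Rightarrow> nat" where
  "norm2 n u = (\<Sum>k\<in>{1..n}. (count_list u k)\<^sup>2)"

lemma norm2_split:
  assumes "1 \<le> i" "i < n"
  shows "norm2 n u = (count_list u i)\<^sup>2 + (count_list u (Suc i))\<^sup>2
    + (\<Sum>k\<in>{1..n} - {i, Suc i}. (count_list u k)\<^sup>2)"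
proof -
  have "{1..n} = {i, Suc i} \<union> ({1..n} - {i, Suc i})" using assms by auto
  then have "norm2 n u = (\<Sum>k\<in>{i, Suc i}. (count_list u k)\<^sup>2)
      + (\<Sum>k\<in>{1..n} - {i, Suc i}. (count_list u k)\<^sup>2)"
    unfolding norm2_def by (subst sum.union_disjoint[symmetric]) auto
  then show ?thesis by simp
qed

lemma norm2_reflect: "1 \<le> i \<Longrightarrow> i < n \<Longrightarrow> norm2 n (reflect i u) = norm2 n u"
  by (simp add: norm2_split count_reflect)

text \<open>The extremal words are the orbit of the highest weight word under the reflections, but
maximality of the norm is easier to work with: no path to that word has to be known.\<close>

definition extremal :: "nat \<Rightarrow> nat list \<Rightarrow> bool" where
  "extremal n u \<longleftrightarrow> (\<forall>v. crystal_class n v = crystal_class n u \<longrightarrow> norm2 n v \<le> norm2 n u)"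

lemma extremal_reflect: "1 \<le> i \<Longrightarrow> i < n \<Longrightarrow> extremal n u \<Longrightarrow> extremal n (reflect i u)"
  by (simp add: extremal_def crystal_class_reflect norm2_reflect)

text \<open>A raising step would move one unit from the smaller to the larger of two entries of the content
and so increase the norm.\<close>

lemma extremal_eps:
  assumes "extremal n u" "1 \<le> i" "i < n" "count_list u (Suc i) \<le> count_list u i"
  shows "eps_word i (Suc i) u = 0"
proof (rule ccontr)
  assume "eps_word i (Suc i) u \<noteq> 0"
  then have e: "0 < eps_word i (Suc i) u" by simp
  define v where "v = raise i (Suc i) u"
  have v: "0 < phi_word i (Suc i) v" "lower i (Suc i) v = u" using raise_step[OF _ e] by (auto simp: v_def)
  note c = count_lower[OF _ v(1), unfolded v(2)]
  have "(\<Sum>k\<in>{1..n} - {i, Suc i}. (count_list u k)\<^sup>2) = (\<Sum>k\<in>{1..n} - {i, Suc i}. (count_list v k)\<^sup>2)"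
    by (rule sum.cong) (auto simp: c(3))
  moreover have "(count_list u i)\<^sup>2 + (count_list u (Suc i))\<^sup>2
      < (count_list v i)\<^sup>2 + (count_list v (Suc i))\<^sup>2"
  proof -
    define p q where "p = count_list u i" and "q = count_list v (Suc i)"
    have "count_list v i = Suc p" "count_list u (Suc i) = Suc q" "Suc q \<le> p"
      using c(1,2) assms(4) by (auto simp: p_def q_def)
    then show ?thesis by (simp add: p_def[symmetric] q_def[symmetric] power2_eq_square)
  qed
  ultimately have "norm2 n u < norm2 n v" using assms by (simp add: norm2_split)
  moreover have "crystal_class n v = crystal_class n u" using e assms by (simp add: v_def crystal_class_raise)
  ultimately show False using assms(1) by (auto simp: extremal_def not_le[symmetric])
qed

lemma extremal_phi:
  assumes "extremal n u" "1 \<le> i" "i < n" "count_list u i \<le> count_list u (Suc i)"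
  shows "phi_word i (Suc i) u = 0"
  using extremal_eps[of n "reflect i u" i] extremal_reflect[of i n u] assms by (simp add: count_reflect)

text \<open>Words of one class have one length, which bounds their norms.\<close>

lemma extremal_exists: "\<exists>v. crystal_class n v = crystal_class n u \<and> extremal n v"
proof -
  have "norm2 n v \<le> n * (length u)\<^sup>2" if "crystal_class n v = crystal_class n u" for v
  proof -
    have "norm2 n v \<le> (\<Sum>k\<in>{1..n}. (length u)\<^sup>2)"
      unfolding norm2_def
      by (intro sum_mono power_mono) (use crystal_class_length[OF that] count_le_length[of v] in auto)
    then show ?thesis by simp
  qed
  then have "\<exists>v. crystal_class n v = crystal_class n u \<and> (\<forall>w. crystal_class n w = crystal_class n u \<longrightarrow> norm2 n w \<le> norm2 n v)"
    using ex_has_greatest_nat[of "\<lambda>v. crystal_class n v = crystal_class n u" u "norm2 n" "Suc (n * (length u)\<^sup>2)"]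
    by (auto simp: less_Suc_eq_le)
  then show ?thesis by (auto simp: extremal_def)
qed

definition content :: "nat \<Rightarrow> nat list \<Rightarrow> nat list" where
  "content n u = map (count_list u) [1..<Suc n]"

lemma mset_content_reflect:
  assumes "1 \<le> i" "i < n"
  shows "mset (content n (reflect i u)) = mset (content n u)"
proof -
  have "count_list (reflect i u) = count_list u \<circ> transpose i (Suc i)" by (auto simp: count_reflect)
  then have "mset (content n (reflect i u)) = image_mset (count_list u) (image_mset (transpose i (Suc i)) (mset [1..<Suc n]))"
    by (simp add: content_def multiset.map_comp del: upt_Suc)
  also have "image_mset (transpose i (Suc i)) (mset [1..<Suc n]) = mset (map (transpose i (Suc i)) [1..<Suc n])"
    by simp
  also have "\<dots> = mset [1..<Suc n]"
  proof (rule set_eq_iff_mset_eq_distinct[THEN iffD1])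
    show "distinct (map (transpose i (Suc i)) [1..<Suc n])"
      by (simp add: distinct_map del: upt_Suc)
    show "set (map (transpose i (Suc i)) [1..<Suc n]) = set [1..<Suc n]"
      using assms by (simp add: transpose_image_eq del: upt_Suc)
  qed simp
  finally show ?thesis by (simp add: content_def del: upt_Suc)
qed

text \<open>The potential for bubble sort: swapping an ascent moves the larger number to the smaller index.\<close>

lemma reflect_potential:
  assumes "1 \<le> i" "i < n" "count_list u i < count_list u (Suc i)"
  shows "(\<Sum>k\<in>{1..n}. k * count_list (reflect i u) k) < (\<Sum>k\<in>{1..n}. k * count_list u k)"
proof -
  have split: "(\<Sum>k\<in>{1..n}. k * count_list w k) = i * count_list w i + Suc i * count_list w (Suc i)
      + (\<Sum>k\<in>{1..n} - {i, Suc i}. k * count_list w k)" for w :: "nat list"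
  proof -
    have "{1..n} = {i, Suc i} \<union> ({1..n} - {i, Suc i})" using assms by auto
    then have "(\<Sum>k\<in>{1..n}. k * count_list w k) = (\<Sum>k\<in>{i, Suc i}. k * count_list w k)
        + (\<Sum>k\<in>{1..n} - {i, Suc i}. k * count_list w k)"
      by (subst sum.union_disjoint[symmetric]) auto
    then show ?thesis by simp
  qed
  have "(\<Sum>k\<in>{1..n} - {i, Suc i}. k * count_list (reflect i u) k)
      = (\<Sum>k\<in>{1..n} - {i, Suc i}. k * count_list u k)"
    by (rule sum.cong) (auto simp: count_reflect)
  moreover have "i * count_list u (Suc i) + Suc i * count_list u i
      < i * count_list u i + Suc i * count_list u (Suc i)"
    using assms(3) by simp
  ultimately show ?thesis unfolding split by (simp add: count_reflect)
qed

text \<open>Reflections with indices from \<open>m\<close> on sort the content of the letters \<open>m, \<dots>, n\<close> and do not touch the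
letters below \<open>m\<close>. The case \<open>m = 1\<close> yields a highest weight word, the case \<open>m = 2\<close> keeps track of the
letters 1.\<close>

lemma bubble_sort:
  assumes "extremal n u" "1 \<le> m"
  shows "\<exists>v. extremal n v \<and> crystal_class n v = crystal_class n u \<and> mset (content n v) = mset (content n u)
    \<and> (\<forall>i. m \<le> i \<longrightarrow> i < n \<longrightarrow> count_list v (Suc i) \<le> count_list v i)
    \<and> (\<forall>c<m. map (\<lambda>x. x = c) v = map (\<lambda>x. x = c) u)"
  using assms(1)
proof (induction "\<Sum>k\<in>{1..n}. k * count_list u k" arbitrary: u rule: less_induct)
  case less
  show ?case
  proof (cases "\<exists>i. m \<le> i \<and> i < n \<and> count_list u i < count_list u (Suc i)")
    case False
    then have "\<forall>i. m \<le> i \<longrightarrow> i < n \<longrightarrow> count_list u (Suc i) \<le> count_list u i" by (meson not_less)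
    then show ?thesis using less.prems by blast
  next
    case True
    then obtain i where i: "m \<le> i" "i < n" "count_list u i < count_list u (Suc i)" by blast
    have i1: "1 \<le> i" using i assms(2) by simp
    from less.hyps[OF reflect_potential[OF i1 i(2,3)] extremal_reflect[OF i1 i(2) less.prems]]
    show ?thesis using i i1 by (auto simp: crystal_class_reflect mset_content_reflect reflect_places)
  qed
qed

lemma extremal_dominant_unique:
  assumes "extremal n u" "extremal n v" "crystal_class n u = crystal_class n v"
    and "\<And>i. 1 \<le> i \<Longrightarrow> i < n \<Longrightarrow> count_list u (Suc i) \<le> count_list u i"
    and "\<And>i. 1 \<le> i \<Longrightarrow> i < n \<Longrightarrow> count_list v (Suc i) \<le> count_list v i"
  shows "u = v"
  using assms by (intro crystal_class_highest_unique[OF assms(3)] extremal_eps) auto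

lemma extremal_content:
  assumes "extremal n u" "extremal n v" "crystal_class n u = crystal_class n v"
  shows "mset (content n u) = mset (content n v)"
proof -
  obtain u' where u': "extremal n u'" "crystal_class n u' = crystal_class n u" "mset (content n u') = mset (content n u)"
    "\<And>i. 1 \<le> i \<Longrightarrow> i < n \<Longrightarrow> count_list u' (Suc i) \<le> count_list u' i"
    using bubble_sort[OF assms(1), of 1] by blast
  obtain v' where v': "extremal n v'" "crystal_class n v' = crystal_class n v" "mset (content n v') = mset (content n v)"
    "\<And>i. 1 \<le> i \<Longrightarrow> i < n \<Longrightarrow> count_list v' (Suc i) \<le> count_list v' i"
    using bubble_sort[OF assms(2), of 1] by blast
  have "u' = v'" using u' v' assms(3) by (intro extremal_dominant_unique) auto
  then show ?thesis using u'(3) v'(3) by simp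
qed

text \<open>Words of equal content are sorted by the same reflections, end in the same highest weight
word, and reflections are invertible.\<close>

lemma extremal_unique:
  assumes "extremal n u" "extremal n v" "crystal_class n u = crystal_class n v"
    and "\<And>k. k \<in> {1..n} \<Longrightarrow> count_list u k = count_list v k"
  shows "u = v"
  using assms
proof (induction "\<Sum>k\<in>{1..n}. k * count_list u k" arbitrary: u v rule: less_induct)
  case less

  show ?case
  proof (cases "\<exists>i. 1 \<le> i \<and> i < n \<and> count_list u i < count_list u (Suc i)")
    case True
    then obtain i where i: "1 \<le> i" "i < n" "count_list u i < count_list u (Suc i)" by blast
    have "reflect i u = reflect i v"
    proof (rule less.hyps[OF reflect_potential[OF i]])
      fix k assume "k \<in> {1..n}"
      then show "count_list (reflect i u) k = count_list (reflect i v) k"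
        using less.prems(4) i by (auto simp: count_reflect transpose_def)
    qed (use i less.prems in \<open>auto simp: extremal_reflect crystal_class_reflect\<close>)
    then show ?thesis by (metis reflect_reflect)
  next
    case False
    then have "count_list u (Suc i) \<le> count_list u i" if "1 \<le> i" "i < n" for i
      using that by (meson not_less)
    then show ?thesis using less.prems by (intro extremal_dominant_unique) auto
  qed
qed

text \<open>Sorting the remaining letters leaves the ones where they are. Since all extremal words of a class
have the same content up to order, the two sorted words have equal content, hence are equal.\<close>

lemma extremal_ones:
  assumes "extremal n u" "extremal n v" "crystal_class n u = crystal_class n v" "1 \<le> n"
    and "count_list u 1 = count_list v 1"
  shows "map (\<lambda>x. x = 1) u = map (\<lambda>x. x = 1) v"
proof -
  have content_Cons: "content n w = count_list w 1 # map (count_list w) [2..<Suc n]" for w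
    using assms(4) upt_conv_Cons[of 1 "Suc n"] by (simp add: content_def numeral_2_eq_2 del: upt_Suc)
  have desc: "sorted (rev (map (count_list w) [2..<Suc n]))"
    if "\<And>i. 2 \<le> i \<Longrightarrow> i < n \<Longrightarrow> count_list w (Suc i) \<le> count_list w i" for w
    unfolding sorted_wrt_rev sorted_wrt_iff_nth_Suc_transp[OF transp_on_ge]
    using that by (auto simp del: upt_Suc)
  obtain u' where u': "extremal n u'" "crystal_class n u' = crystal_class n u" "mset (content n u') = mset (content n u)"
    "\<And>i. 2 \<le> i \<Longrightarrow> i < n \<Longrightarrow> count_list u' (Suc i) \<le> count_list u' i"
    "map (\<lambda>x. x = 1) u' = map (\<lambda>x. x = 1) u"
    using bubble_sort[OF assms(1), of 2] by force
  obtain v' where v': "extremal n v'" "crystal_class n v' = crystal_class n v" "mset (content n v') = mset (content n v)"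
    "\<And>i. 2 \<le> i \<Longrightarrow> i < n \<Longrightarrow> count_list v' (Suc i) \<le> count_list v' i"
    "map (\<lambda>x. x = 1) v' = map (\<lambda>x. x = 1) v"
    using bubble_sort[OF assms(2), of 2] by force
  have one: "count_list u' 1 = count_list v' 1"
    using u'(5) v'(5) assms(5) by (metis count_list_places)
  have "mset (content n u') = mset (content n v')"
    using u' v' extremal_content[OF assms(1-3)] by simp
  then have "mset (rev (map (count_list u') [2..<Suc n])) = mset (rev (map (count_list v') [2..<Suc n]))"
    using one by (simp add: content_Cons del: upt_Suc)
  then have "map (count_list u') [2..<Suc n] = map (count_list v') [2..<Suc n]"
    using desc[OF u'(4)] desc[OF v'(4)] properties_for_sort rev_rev_ident by metis
  then have "count_list u' k = count_list v' k" if "k \<in> {1..n}" for k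
    using that one by (cases "k = 1") (auto simp del: upt_Suc)
  then have "u' = v'" using u' v' assms(3) by (intro extremal_unique) auto
  then show ?thesis using u'(5) v'(5) by simp
qed

text \<open>Bubble sort of some extremal word of the class ends in a highest weight word, and there is
only one.\<close>

lemma extremal_highest:
  assumes "\<And>i. 1 \<le> i \<Longrightarrow> i < n \<Longrightarrow> eps_word i (Suc i) u = 0"
  shows "extremal n u"
proof -
  obtain w where w: "crystal_class n w = crystal_class n u" "extremal n w" using extremal_exists by blast
  obtain v where v: "extremal n v" "crystal_class n v = crystal_class n u"
    "\<And>i. 1 \<le> i \<Longrightarrow> i < n \<Longrightarrow> count_list v (Suc i) \<le> count_list v i"
    using bubble_sort[OF w(2), of 1] w(1) by auto
  have "v = u" using v assms by (intro crystal_class_highest_unique[OF v(2)]) (auto intro: extremal_eps)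
  then show ?thesis using v by simp
qed

section \<open>Products of reflections\<close>

lemma foldr_reflect_extremal:
  assumes "set is \<subseteq> {1..<n}"
  shows "crystal_class n (foldr reflect is u) = crystal_class n u"
    and "extremal n u \<Longrightarrow> extremal n (foldr reflect is u)"
  using assms by (induction "is") (auto simp: crystal_class_reflect extremal_reflect)

lemma length_foldr_reflect [simp]: "length (foldr reflect is u) = length u"
  by (induction "is") auto

lemma count_cycle:
  "count_list (foldr reflect (rev [1..<Suc k]) u) j =
    (if 1 \<le> j \<and> j \<le> k then count_list u (Suc j) else if j = Suc k then count_list u 1 else count_list u j)"
proof (induction k arbitrary: j)
  case (Suc k)
  then show ?case by (auto simp: count_reflect transpose_def)
qed auto

lemma count_cycle':
  "1 \<le> i \<Longrightarrow> count_list (foldr reflect [1..<i] u) 1 = count_list u i"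
proof (induction i arbitrary: u)
  case (Suc i)
  then show ?case by (cases "i = 0") (auto simp: count_reflect)
qed simp

lemma count_w0:
  "count_list (foldr reflect (word_w0 k) u) j =
    (if 1 \<le> j \<and> j \<le> k then count_list u (Suc k - j) else count_list u j)"
proof (induction k arbitrary: u j)
  case (Suc k)
  have "count_list (foldr reflect (word_w0 (Suc k)) u) j = count_list (foldr reflect (word_w0 k) (foldr reflect (rev [1..<Suc k]) u)) j"
    by (simp add: word_w0_Suc del: upt_Suc)
  then show ?case
    unfolding Suc.IH count_cycle by (auto simp: Suc_diff_le le_Suc_eq)
qed (simp add: word_w0_def)

text \<open>The product along the longest word makes a dominant content increasing, which produces an
extremal lowest weight word; there is only one.\<close>

lemma extremal_lowest:
  assumes "\<And>i. 1 \<le> i \<Longrightarrow> i < n \<Longrightarrow> phi_word i (Suc i) u = 0"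
  shows "extremal n u"
proof -
  obtain w where w: "crystal_class n w = crystal_class n u" "extremal n w" using extremal_exists by blast
  obtain v where v: "extremal n v" "crystal_class n v = crystal_class n u"
    "\<And>i. 1 \<le> i \<Longrightarrow> i < n \<Longrightarrow> count_list v (Suc i) \<le> count_list v i"
    using bubble_sort[OF w(2), of 1] w(1) by auto
  define z where "z = foldr reflect (word_w0 n) v"
  have z: "extremal n z" "crystal_class n z = crystal_class n u"
    using foldr_reflect_extremal[OF set_word_w0] v by (auto simp: z_def)
  have "count_list z i \<le> count_list z (Suc i)" if "1 \<le> i" "i < n" for i
    using that v(3)[of "n - i"] by (simp add: z_def count_w0 Suc_diff_le)
  then have "z = u" using z(1) assms by (intro crystal_class_lowest_unique[OF z(2)]) (auto intro: extremal_phi)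
  then show ?thesis using z by simp
qed

section \<open>The first 1 of an extremal word\<close>

definition first1 :: "nat list \<Rightarrow> nat" where
  "first1 u = length (takeWhile (\<lambda>b. \<not> b) (map (\<lambda>x. x = 1) u))"

lemma first1_simps [simp]:
  "first1 [] = 0"
  "first1 (x # u) = (if x = 1 then 0 else Suc (first1 u))"
  by (auto simp: first1_def)

lemma first1_less: "first1 u < length u \<longleftrightarrow> 0 < count_list u 1"
  by (induction u) auto

text \<open>By \<open>extremal_ones\<close> all choices of \<open>z\<close> give the same value. The numbers \<open>v\<close> of interest are entries of
the content of an extremal word \<open>u\<close>, and for these a \<open>z\<close> exists. If \<open>v = 0\<close> the value is the length of the words, which is not a
position.\<close>

definition first_pos :: "nat \<Rightarrow> nat list \<Rightarrow> nat \<Rightarrow> nat" where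
  "first_pos n u v = first1 (SOME z. extremal n z \<and> crystal_class n z = crystal_class n u \<and> count_list z 1 = v)"

lemma first_pos_eq:
  assumes "extremal n z" "crystal_class n z = crystal_class n u" "1 \<le> n"
  shows "first_pos n u (count_list z 1) = first1 z"
proof -
  define y where "y = (SOME y. extremal n y \<and> crystal_class n y = crystal_class n u \<and> count_list y 1 = count_list z 1)"
  have "extremal n y \<and> crystal_class n y = crystal_class n u \<and> count_list y 1 = count_list z 1"
    unfolding y_def by (rule someI[of _ z]) (use assms in auto)
  then have "map (\<lambda>x. x = 1) y = map (\<lambda>x. x = 1) z"
    using extremal_ones[of n y z] assms by simp
  then show ?thesis unfolding first_pos_def y_def[symmetric] by (simp add: first1_def)
qed

lemma first_pos_crystal_class: "crystal_class n u = crystal_class n v \<Longrightarrow> first_pos n u = first_pos n v"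
  by (simp add: first_pos_def[abs_def])

text \<open>The reflections that conjugate the zero operators to index \<open>i\<close> bring the number of letters \<open>i\<close> to
place 1.\<close>

lemma first_pos_count:
  assumes "extremal n u" "1 \<le> i" "i \<le> n"
  shows "first_pos n u (count_list u i) = first1 (foldr reflect [1..<i] u)"
proof -
  have s: "set [1..<i] \<subseteq> {1..<n}" using assms by auto
  show ?thesis
    using first_pos_eq[OF foldr_reflect_extremal(2)[OF s assms(1)] foldr_reflect_extremal(1)[OF s]] assms
    by (simp add: count_cycle'[simplified])
qed

lemma first_pos_less:
  assumes "extremal n u" "1 \<le> i" "i \<le> n"
  shows "first_pos n u (count_list u i) < length u \<longleftrightarrow> 0 < count_list u i"
  using first1_less[of "foldr reflect [1..<i] u"] assms by (simp add: first_pos_count count_cycle'[simplified])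

section \<open>Reflections of marked words\<close>

text \<open>Updating a list outside of its range has no effect, which is right for words without letter 1:
their \<open>first1\<close> is their length.\<close>

definition toggle :: "nat \<Rightarrow> bool list \<Rightarrow> bool list" where
  "toggle p m = m[p := \<not> m ! p]"

lemma length_fold_toggle [simp]: "length (fold toggle ps m) = length m"
  by (induction ps arbitrary: m) (auto simp: toggle_def)

lemma fold_toggle_nth:
  "distinct (filter (\<lambda>p. p < length m) ps) \<Longrightarrow> p < length m \<Longrightarrow>
    fold toggle ps m ! p = (if p \<in> set ps then \<not> m ! p else m ! p)"
proof (induction ps arbitrary: m)
  case (Cons q ps)
  then show ?case
    by (auto simp: toggle_def nth_list_update split: if_splits)
qed simp

text \<open>This is \<open>\<sigma>\<^sub>i\<close> on a word of numbers with marks.\<close>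

definition reflect_marked :: "nat \<Rightarrow> nat list \<times> bool list \<Rightarrow> nat list \<times> bool list" where
  "reflect_marked i s = (if i = 0 then (fst s, toggle (first1 (fst s)) (snd s)) else (reflect i (fst s), snd s))"

lemma foldr_reflect_marked_nonzero: "0 \<notin> set is \<Longrightarrow> foldr reflect_marked is (u, m) = (foldr reflect is u, m)"
  by (induction "is") (auto simp: reflect_marked_def)

lemma word_w0_plus_Suc: "word_w0_plus (Suc k) = word_w0_plus k @ rev [1..<Suc k] @ [0]"
proof -
  have "[0..<Suc k] = 0 # [1..<Suc k]" using upt_conv_Cons[of 0 "Suc k"] by simp
  moreover have "word_w0_plus (Suc k) = word_w0_plus k @ rev [0..<Suc k]"
    by (simp add: word_w0_plus_def)
  ultimately show ?thesis by (simp del: upt_Suc)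
qed

text \<open>Each block first flips the mark at the first 1 and then cycles the content, so that the next block
finds the next entry of the original content at place 1.\<close>

lemma foldr_reflect_marked_w0_plus:
  assumes "1 \<le> n" "k \<le> n" "extremal n u"
  shows "foldr reflect_marked (word_w0_plus k) (u, m) =
    (foldr reflect (word_w0 k) u, fold toggle (map (\<lambda>j. first_pos n u (count_list u j)) [1..<Suc k]) m)"
  using assms(2,3)
proof (induction k arbitrary: u m)
  case (Suc k)
  define u1 where "u1 = foldr reflect (rev [1..<Suc k]) u"
  have s: "set (rev [1..<Suc k]) \<subseteq> {1..<n}" using Suc.prems by auto
  have u1: "extremal n u1" "crystal_class n u1 = crystal_class n u"
    using foldr_reflect_extremal[OF s] Suc.prems by (auto simp: u1_def)
  have "foldr reflect_marked (word_w0_plus (Suc k)) (u, m)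
      = foldr reflect_marked (word_w0_plus k) (u1, toggle (first1 u) m)"
    by (simp add: word_w0_plus_Suc reflect_marked_def[of 0] foldr_reflect_marked_nonzero u1_def del: upt_Suc)
  also have "\<dots> = (foldr reflect (word_w0 k) u1,
      fold toggle (map (\<lambda>j. first_pos n u1 (count_list u1 j)) [1..<Suc k]) (toggle (first1 u) m))"
    using Suc u1 by simp
  also have "map (\<lambda>j. first_pos n u1 (count_list u1 j)) [1..<Suc k]
      = map (\<lambda>j. first_pos n u (count_list u (Suc j))) [1..<Suc k]"
    unfolding u1_def count_cycle using first_pos_crystal_class[OF u1(2)] by (simp add: u1_def del: upt_Suc)
  also have "\<dots> = map (\<lambda>j. first_pos n u (count_list u j)) (map Suc [1..<Suc k])"
    by (simp only: map_map o_def)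
  also have "map Suc [1..<Suc k] = [2..<Suc (Suc k)]" by (simp only: map_Suc_upt numeral_2_eq_2 One_nat_def)
  also have "first1 u = first_pos n u (count_list u 1)" using first_pos_count[of n u 1] Suc.prems assms(1) by simp
  finally show ?case
    using upt_conv_Cons[of 1 "Suc (Suc k)"]
    by (simp add: word_w0_Suc u1_def numeral_2_eq_2 del: upt_Suc)
qed (simp add: word_w0_plus_def word_w0_def)

section \<open>The barred operators separate the positions\<close>

text \<open>The words on which the barred \<open>e\<^sub>1\<close> is nonzero, see \<open>fbar1_image\<close>.\<close>

definition starts_with_2 :: "nat list \<Rightarrow> bool" where
  "starts_with_2 u \<longleftrightarrow> (\<exists>t. filter (\<lambda>x. x = 1 \<or> x = 2) u = 2 # t)"

text \<open>The barred \<open>e\<^sub>i\<close> is the barred \<open>e\<^sub>1\<close> conjugated by reflections; it is applied to this word. On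
extremal words the reflections bring the entries \<open>i\<close> and \<open>i + 1\<close> of the content to places 1 and 2.\<close>

fun bar_word :: "nat \<Rightarrow> nat list \<Rightarrow> nat list" where
  "bar_word (Suc (Suc i)) u = bar_word (Suc i) (reflect (Suc (Suc i)) (reflect (Suc i) u))"
| "bar_word _ u = u"

lemma bar_word_facts:
  assumes "1 \<le> i" "i < n" "extremal n u"
  shows "extremal n (bar_word i u) \<and> crystal_class n (bar_word i u) = crystal_class n u
    \<and> count_list (bar_word i u) 1 = count_list u i \<and> count_list (bar_word i u) 2 = count_list u (Suc i)"
  using assms
proof (induction i u rule: bar_word.induct)
  case (1 i u)
  then show ?case by (simp add: extremal_reflect crystal_class_reflect count_reflect transpose_def)
qed (auto simp: numeral_2_eq_2)

text \<open>The first letter among 1, 2 sits at the same place in both words. In \<open>x\<close> it is a 1; in \<open>y\<close> it cannot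
be a 1, because that 1 would be free.\<close>

lemma first1_increases:
  assumes "map (\<lambda>a. a = 1 \<or> a = 2) x = map (\<lambda>a. a = 1 \<or> a = 2) y"
    and "phi_word 1 2 y = 0" "\<not> starts_with_2 x" "0 < count_list x 1"
  shows "first1 x < first1 y"
proof -
  have "length x = length y" using assms(1) map_eq_imp_length_eq by blast
  then show ?thesis using assms
  proof (induction x y rule: list_induct2)
    case (Cons a x b y)
    show ?case
    proof (cases "a = 1 \<or> a = 2")
      case True
      then have "a = 1" "b \<noteq> 1" using Cons.prems by (auto simp: starts_with_2_def)
      then show ?thesis by simp
    next
      case False
      then show ?thesis using Cons by (auto simp: starts_with_2_def)
    qed
  qed simp
qed

text \<open>Compare the word \<open>z\<close> to which the barred \<open>e\<^sub>1\<close> is applied with its reflection \<open>\<sigma>\<^sub>1 z\<close>. Their numbers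
of ones are the two entries in question, they have the same places for letters 1 and 2, and in
\<open>\<sigma>\<^sub>1 z\<close> every 1 is matched.\<close>

lemma first_pos_increasing:
  assumes "extremal n c" "1 \<le> i" "i < n" "0 < count_list c i"
    and "count_list c (Suc i) \<le> count_list c i" "\<not> starts_with_2 (bar_word i c)"
  shows "first_pos n c (count_list c i) < first_pos n c (count_list c (Suc i))"
proof -
  define z where "z = bar_word i c"
  have z: "extremal n z" "crystal_class n z = crystal_class n c" "count_list z 1 = count_list c i" "count_list z 2 = count_list c (Suc i)"
    using bar_word_facts[OF assms(2,3,1)] by (auto simp: z_def)
  have n: "1 < n" using assms by simp
  have s: "extremal n (reflect 1 z)" "crystal_class n (reflect 1 z) = crystal_class n c" "count_list (reflect 1 z) 1 = count_list c (Suc i)"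
    using z n by (auto simp: extremal_reflect crystal_class_reflect count_reflect numeral_2_eq_2)
  have "first1 z < first1 (reflect 1 z)"
  proof (rule first1_increases)
    show "map (\<lambda>a. a = 1 \<or> a = 2) z = map (\<lambda>a. a = 1 \<or> a = 2) (reflect 1 z)"
      using reflect_places(1)[of 1 z] by (simp add: numeral_2_eq_2)
    show "phi_word 1 2 (reflect 1 z) = 0"
      using extremal_eps[OF z(1), of 1] n z assms(5) phi_reflect[of 1 z] by (simp add: numeral_2_eq_2)
  qed (use assms z z_def in auto)
  then show ?thesis using first_pos_eq[OF z(1,2)] first_pos_eq[OF s(1,2)] n z s by simp
qed

lemma first_pos_distinct:
  assumes "extremal n c"
    and dom: "\<And>i. 1 \<le> i \<Longrightarrow> i < n \<Longrightarrow> count_list c (Suc i) \<le> count_list c i"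
    and bar: "\<And>i. 1 \<le> i \<Longrightarrow> i < n \<Longrightarrow> \<not> starts_with_2 (bar_word i c)"
    and "1 \<le> i" "i < j" "j \<le> n" "0 < count_list c j"
  shows "first_pos n c (count_list c i) < first_pos n c (count_list c j)"
  using assms(5-7)
proof (induction j)
  case (Suc j)
  have j: "1 \<le> j" "j < n" "0 < count_list c j" using Suc.prems assms(4) dom[of j] by auto
  note * = first_pos_increasing[OF assms(1) j(1,2,3) dom[OF j(1,2)] bar[OF j(1,2)]]
  show ?case
  proof (cases "i = j")
    case False
    then show ?thesis using Suc j * by simp
  qed (use * in simp)
qed simp

text \<open>The positions that are read before and after the flips are the same, and by
\<open>first_pos_distinct\<close> those that lie inside the word are pairwise distinct.\<close>

lemma marks_flipped:
  assumes "1 \<le> n" "extremal n b" "extremal n c" "crystal_class n b = crystal_class n c"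
    and rev: "\<And>i. 1 \<le> i \<Longrightarrow> i \<le> n \<Longrightarrow> count_list b i = count_list c (Suc n - i)"
    and dom: "\<And>i. 1 \<le> i \<Longrightarrow> i < n \<Longrightarrow> count_list c (Suc i) \<le> count_list c i"
    and bar: "\<And>i. 1 \<le> i \<Longrightarrow> i < n \<Longrightarrow> \<not> starts_with_2 (bar_word i c)"
    and len: "length m = length b"
  defines "m' \<equiv> fold toggle (map (\<lambda>j. first_pos n b (count_list b j)) [1..<Suc n]) m"
  defines "pb \<equiv> \<lambda>i. first1 (foldr reflect [1..<i] b)" and "pc \<equiv> \<lambda>i. first1 (foldr reflect [1..<i] c)"
  shows "(\<forall>i\<in>{1..n}. pb i < length b \<longrightarrow> m ! pb i) \<longleftrightarrow> (\<forall>i\<in>{1..n}. pc i < length b \<longrightarrow> \<not> m' ! pc i)"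
proof -
  have lc: "length c = length b" using crystal_class_length[OF assms(4)] by simp
  have pc: "pc i = first_pos n c (count_list c i)" if "1 \<le> i" "i \<le> n" for i
    using that by (simp add: pc_def first_pos_count assms)
  \<comment> \<open>Both positions depend only on the number of ones, and the contents are reversals of each other.\<close>
  have pb: "pb i = pc (Suc n - i)" if "1 \<le> i" "i \<le> n" for i
    using that pc[of "Suc n - i"] first_pos_crystal_class[OF assms(4)] first_pos_count[OF assms(2) that] by (simp add: pb_def rev)
  have ps: "map (\<lambda>j. first_pos n b (count_list b j)) [1..<Suc n] = map pb [1..<Suc n]"
    using first_pos_count[OF assms(2)] by (simp add: pb_def del: upt_Suc)
  have inj: "i = j" if "pc i = pc j" "pc i < length b" "i \<in> {1..n}" "j \<in> {1..n}" for i j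
  proof (rule ccontr)
    assume "i \<noteq> j"
    have "0 < count_list c i" "0 < count_list c j"
      using first_pos_less[OF assms(3), of i] first_pos_less[OF assms(3), of j] pc[of i] pc[of j] that lc by auto
    then show False
      using first_pos_distinct[OF assms(3) dom bar, of i j] first_pos_distinct[OF assms(3) dom bar, of j i]
        \<open>i \<noteq> j\<close> that pc by (cases i j rule: linorder_cases) auto
  qed
  have "distinct (filter (\<lambda>p. p < length m) (map pb [1..<Suc n]))"
    unfolding filter_map distinct_map
  proof
    show "inj_on pb (set (filter ((\<lambda>p. p < length m) \<circ> pb) [1..<Suc n]))"
    proof (rule inj_onI)
      fix i j
      assume "i \<in> set (filter ((\<lambda>p. p < length m) \<circ> pb) [1..<Suc n])"
        "j \<in> set (filter ((\<lambda>p. p < length m) \<circ> pb) [1..<Suc n])" "pb i = pb j"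
      then have "Suc n - i = Suc n - j" "i \<le> n" "j \<le> n"
        using pb[of i] pb[of j] len by (auto intro!: inj simp del: upt_Suc)
      then show "i = j" by simp
    qed
  qed simp
  from fold_toggle_nth[OF this]
  have m': "m' ! pb i = (\<not> m ! pb i)" if "i \<in> {1..n}" "pb i < length b" for i
    using that len unfolding m'_def ps by (auto simp del: upt_Suc)
  have "(\<forall>i\<in>{1..n}. pc i < length b \<longrightarrow> \<not> m' ! pc i) \<longleftrightarrow> (\<forall>i\<in>{1..n}. pb i < length b \<longrightarrow> \<not> m' ! pb i)"
  proof (intro iffI ballI impI)
    fix i assume "\<forall>i\<in>{1..n}. pc i < length b \<longrightarrow> \<not> m' ! pc i" "i \<in> {1..n}" "pb i < length b"
    moreover have "Suc n - i \<in> {1..n}" using \<open>i \<in> {1..n}\<close> by auto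
    ultimately show "\<not> m' ! pb i" using pb[of i] by (metis atLeastAtMost_iff)
  next
    fix i assume "\<forall>i\<in>{1..n}. pb i < length b \<longrightarrow> \<not> m' ! pb i" "i \<in> {1..n}" "pc i < length b"
    moreover have "Suc n - i \<in> {1..n}" "pb (Suc n - i) = pc i"
      using \<open>i \<in> {1..n}\<close> pb[of "Suc n - i"] by auto
    ultimately show "\<not> m' ! pc i" by metis
  qed
  then show ?thesis using m' by auto
qed

section \<open>Tensor powers of the standard crystal\<close>

lemma lift_simps [simp]: "lift g None = None" "lift g (Some x) = g x"
  by (simp_all add: lift_def)

lemma lift_funpow_None [simp]: "(lift g ^^ k) None = None"
  by (induction k) auto

lemma lift_funpow_string:
  assumes "\<And>x. x \<in> X \<Longrightarrow> 0 < p x \<Longrightarrow> \<exists>y\<in>X. g x = Some y \<and> Suc (p y) = p x"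
    and "x \<in> X" "k \<le> p x"
  shows "\<exists>y\<in>X. (lift g ^^ k) (Some x) = Some y \<and> p y = p x - k"
  using assms(3)
proof (induction k)
  case (Suc k)
  then obtain y where y: "y \<in> X" "(lift g ^^ k) (Some x) = Some y" "p y = p x - k" by auto
  then show ?case using Suc.prems assms(1)[of y] by auto
qed (use assms in auto)

text \<open>This identifies the counts of free letters with the string lengths of the crystal.\<close>

lemma string_length_eq:
  assumes none: "\<And>x. x \<in> X \<Longrightarrow> p x = 0 \<Longrightarrow> g x = None"
    and some: "\<And>x. x \<in> X \<Longrightarrow> 0 < p x \<Longrightarrow> \<exists>y\<in>X. g x = Some y \<and> Suc (p y) = p x"
    and x: "x \<in> X"
  shows "string_length g x = enat (p x)"
proof -
  have "(lift g ^^ k) (Some x) \<noteq> None \<longleftrightarrow> k \<le> p x" for k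
  proof (cases "k \<le> p x")
    case True
    then show ?thesis using lift_funpow_string[OF some x] by fastforce
  next
    case False
    obtain y where y: "y \<in> X" "(lift g ^^ p x) (Some x) = Some y" "p y = 0"
      using lift_funpow_string[OF some x, of "p x"] by auto
    have "(lift g ^^ Suc (p x)) (Some x) = None" using y none by simp
    moreover have "(lift g ^^ k) (Some x) = (lift g ^^ (k - Suc (p x))) ((lift g ^^ Suc (p x)) (Some x))"
      using False by (metis comp_apply funpow_add le_add_diff_inverse2 not_less_eq_eq)
    ultimately show ?thesis using False by simp
  qed
  then have "{k. (lift g ^^ k) (Some x) \<noteq> None} = {..p x}" by auto
  moreover have "(SUP k\<in>{..p x}. enat k) = enat (p x)"
    by (intro antisym SUP_least) (auto intro: SUP_upper)
  ultimately show ?thesis by (simp add: string_length_def)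
qed

fun letter_value :: "letter \<Rightarrow> nat" where
  "letter_value (Box i) = i"
| "letter_value (Prim i) = i"

fun primed :: "letter \<Rightarrow> bool" where
  "primed (Box i) = False"
| "primed (Prim i) = True"

lemma letter_eqI: "letter_value a = letter_value b \<Longrightarrow> primed a = primed b \<Longrightarrow> a = b"
  by (cases a; cases b) auto

lemma word_eqI: "map letter_value v = map letter_value w \<Longrightarrow> map primed v = map primed w \<Longrightarrow> v = w"
proof (induction v arbitrary: w)
  case (Cons a v)
  then show ?case by (cases w) (auto intro: letter_eqI)
qed simp

lemma elts_std: "b \<in> elts (std_crystal n) \<longleftrightarrow> 1 \<le> letter_value b \<and> letter_value b \<le> n"
  by (cases b) (auto simp: std_crystal_def)

declare tensor_power.simps(2) [simp del]

lemma elts_tensor_power_Suc: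
  "w \<in> elts (tensor_power n (Suc m)) \<longleftrightarrow>
    (\<exists>b c. w = b # c \<and> b \<in> elts (std_crystal n) \<and> c \<in> elts (tensor_power n m))"
  by (auto simp: Let_def tensor_def tensor_power.simps(2))

lemma tensor_power_ops:
  "fop (tensor_power n (Suc m)) i (b # c) =
    map_option (\<lambda>(b, w). b # w) (tensor_f (std_crystal n) (tensor_power n m) i (b, c))"
  "eop (tensor_power n (Suc m)) i (b # c) =
    map_option (\<lambda>(b, w). b # w) (tensor_e (std_crystal n) (tensor_power n m) i (b, c))"
  by (simp_all add: Let_def tensor_def tensor_power.simps(2))

lemma wt_std: "wt (std_crystal n) b k = (if letter_value b = k then 1 else 0)"
  by (cases b) (auto simp: std_crystal_def unit_wt_def)

lemma eps_std:
  assumes "1 \<le> i" "i < n"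
  shows "eps (std_crystal n) (Op i) b = enat (if letter_value b = Suc i then 1 else 0)"
  unfolding eps_def
proof (rule string_length_eq[where X = UNIV and p = "\<lambda>b. if letter_value b = Suc i then 1 else 0"])
  fix b :: letter
  show "eop (std_crystal n) (Op i) b = None" if "(if letter_value b = Suc i then 1 else 0) = (0::nat)"
    using that assms by (cases b) (auto simp: std_crystal_def split: if_splits)
  show "\<exists>y\<in>UNIV. eop (std_crystal n) (Op i) b = Some y \<and>
      Suc (if letter_value y = Suc i then 1 else 0) = (if letter_value b = Suc i then 1 else 0)"
    if "0 < (if letter_value b = Suc i then 1 else (0::nat))"
    using that assms by (cases b) (auto simp: std_crystal_def split: if_splits)
qed simp

lemma fop_std:
  assumes "1 \<le> i" "i < n"
  shows "letter_value b \<noteq> i \<Longrightarrow> fop (std_crystal n) (Op i) b = None"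
    and "letter_value b = i \<Longrightarrow> \<exists>b'. fop (std_crystal n) (Op i) b = Some b' \<and> letter_value b' = Suc i \<and> primed b' = primed b"
  using assms by (cases b; auto simp: std_crystal_def)+

text \<open>The tensor product rule, read letter by letter, is the recursion defining \<open>lower\<close>; the required
value of \<open>\<phi>\<^sub>i\<close> on the shorter word comes from the induction hypothesis along its string.\<close>

lemma fop_tensor_power:
  assumes i: "1 \<le> i" "i < n"
  shows "w \<in> elts (tensor_power n m) \<Longrightarrow> phi_word i (Suc i) (map letter_value w) = 0 \<Longrightarrow>
      fop (tensor_power n m) (Op i) w = None"
    and "w \<in> elts (tensor_power n m) \<Longrightarrow> 0 < phi_word i (Suc i) (map letter_value w) \<Longrightarrow>
      \<exists>v\<in>elts (tensor_power n m). fop (tensor_power n m) (Op i) w = Some v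
        \<and> map letter_value v = lower i (Suc i) (map letter_value w) \<and> map primed v = map primed w"
proof (induction m arbitrary: w)
  case 0
  { case 1 then show ?case by simp }
  { case 2 then show ?case by simp }
next
  case (Suc m)
  let ?T = "tensor_power n m"
  have phi: "phi ?T (Op i) c = enat (phi_word i (Suc i) (map letter_value c))" if "c \<in> elts ?T" for c
    unfolding phi_def
  proof (rule string_length_eq[where X = "elts ?T" and p = "\<lambda>c. phi_word i (Suc i) (map letter_value c)"])
    fix x assume x: "x \<in> elts ?T" "0 < phi_word i (Suc i) (map letter_value x)"
    then show "\<exists>y\<in>elts ?T. fop ?T (Op i) x = Some y
        \<and> Suc (phi_word i (Suc i) (map letter_value y)) = phi_word i (Suc i) (map letter_value x)"
      using Suc.IH(2)[OF x] lower_step[of i "Suc i" "map letter_value x"] by auto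
  qed (use Suc.IH(1) that in auto)
  have op: "fop (tensor_power n (Suc m)) (Op i) (b # c) =
      (if (if letter_value b = Suc i then 1 else 0) < phi_word i (Suc i) (map letter_value c) then map_option ((#) b) (fop ?T (Op i) c)
       else map_option (\<lambda>b'. b' # c) (fop (std_crystal n) (Op i) b))" if "c \<in> elts ?T" for b c
    using i that by (cases "fop ?T (Op i) c"; cases "fop (std_crystal n) (Op i) b")
      (auto simp: tensor_power_ops eps_std phi opt_pair_def)
  { case 1
    then obtain b c where w: "w = b # c" "b \<in> elts (std_crystal n)" "c \<in> elts ?T"
      by (auto simp only: elts_tensor_power_Suc)
    have "letter_value b \<noteq> i" "\<not> (if letter_value b = Suc i then 1 else 0) < phi_word i (Suc i) (map letter_value c)"
      using 1 w by (auto split: if_splits)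
    then show ?case using fop_std(1)[OF i, of b] by (simp only: w(1) op[OF w(3)] if_False) simp }
  { case 2
    then obtain b c where w: "w = b # c" "b \<in> elts (std_crystal n)" "c \<in> elts ?T"
      by (auto simp only: elts_tensor_power_Suc)
    show ?case
    proof (cases "(if letter_value b = Suc i then 1 else 0) < phi_word i (Suc i) (map letter_value c)")
      case True
      then have "0 < phi_word i (Suc i) (map letter_value c)" by (auto split: if_splits)
      from Suc.IH(2)[OF w(3) this] obtain v where "v \<in> elts ?T" "fop ?T (Op i) c = Some v"
        "map letter_value v = lower i (Suc i) (map letter_value c)" "map primed v = map primed c" by blast
      moreover have "fop (tensor_power n (Suc m)) (Op i) w = map_option ((#) b) (fop ?T (Op i) c)"
        unfolding w(1) op[OF w(3)] using True by (simp only: if_True)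
      ultimately show ?thesis using w \<open>0 < phi_word i (Suc i) (map letter_value c)\<close>
        by (intro bexI[of _ "b # v"]) (simp_all add: elts_tensor_power_Suc)
    next
      case False
      then have b: "letter_value b = i" "phi_word i (Suc i) (map letter_value c) = 0" using 2 w by (auto split: if_splits)
      then obtain b' where "fop (std_crystal n) (Op i) b = Some b'" "letter_value b' = Suc i" "primed b' = primed b"
        using fop_std(2)[OF i] by blast
      then show ?thesis using w False op b i
        by (intro bexI[of _ "b' # c"])
          (auto simp: elts_tensor_power_Suc elts_std)
    qed }
qed

lemma elts_tensor_power:
  "w \<in> elts (tensor_power n m) \<longleftrightarrow> length w = m \<and> (\<forall>k\<in>set (map letter_value w). 1 \<le> k \<and> k \<le> n)"
proof (induction m arbitrary: w)
  case (Suc m)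
  then show ?case by (cases w) (auto simp: elts_tensor_power_Suc elts_std)
qed auto

lemma word_exists:
  assumes "length u = length m"
  obtains w where "map letter_value w = u" "map primed w = m"
proof
  show "map letter_value (map2 (\<lambda>k p. if p then Prim k else Box k) u m) = u"
    using assms by (induction u m rule: list_induct2) auto
  show "map primed (map2 (\<lambda>k p. if p then Prim k else Box k) u m) = m"
    using assms by (induction u m rule: list_induct2) auto
qed

lemma set_raise: "set (raise a b u) \<subseteq> insert a (set u)"
  by (induction u) auto

lemma fop_tensor_power_preimage:
  assumes i: "1 \<le> i" "i < n" and w: "w \<in> elts (tensor_power n m)"
  shows "eps_word i (Suc i) (map letter_value w) = 0 \<Longrightarrow> v \<in> elts (tensor_power n m) \<Longrightarrow>
      fop (tensor_power n m) (Op i) v \<noteq> Some w"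
    and "0 < eps_word i (Suc i) (map letter_value w) \<Longrightarrow>
      \<exists>v\<in>elts (tensor_power n m). fop (tensor_power n m) (Op i) v = Some w
        \<and> map letter_value v = raise i (Suc i) (map letter_value w) \<and> map primed v = map primed w"
proof -
  let ?T = "tensor_power n m"
  show "fop ?T (Op i) v \<noteq> Some w" if e: "eps_word i (Suc i) (map letter_value w) = 0" and v: "v \<in> elts ?T"
  proof
    assume f: "fop ?T (Op i) v = Some w"
    then have "0 < phi_word i (Suc i) (map letter_value v)" using fop_tensor_power(1)[OF i v] by fastforce
    then have "map letter_value w = lower i (Suc i) (map letter_value v)" "0 < phi_word i (Suc i) (map letter_value v)"
      using fop_tensor_power(2)[OF i v] f by auto
    then show False using lower_step[of i "Suc i" "map letter_value v"] e by simp
  qed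
  show "\<exists>v\<in>elts ?T. fop ?T (Op i) v = Some w \<and> map letter_value v = raise i (Suc i) (map letter_value w)
      \<and> map primed v = map primed w" if e: "0 < eps_word i (Suc i) (map letter_value w)"
  proof -
    obtain v where v: "map letter_value v = raise i (Suc i) (map letter_value w)" "map primed v = map primed w"
      using word_exists[of "raise i (Suc i) (map letter_value w)" "map primed w"] by auto
    have "length v = length w" using v(2) by (metis length_map)
    then have vT: "v \<in> elts ?T"
      using w set_raise[of i "Suc i" "map letter_value w"] i unfolding elts_tensor_power v(1) by fastforce
    have s: "0 < phi_word i (Suc i) (map letter_value v)" "lower i (Suc i) (map letter_value v) = map letter_value w"
      using raise_step[of i "Suc i" "map letter_value w"] e by (auto simp: v(1))
    then obtain w' where "fop ?T (Op i) v = Some w'" "map letter_value w' = map letter_value w" "map primed w' = map primed v"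
      using fop_tensor_power(2)[OF i vT s(1)] by auto
    then have "fop ?T (Op i) v = Some w" using v(2) word_eqI[of w' w] by simp
    then show ?thesis using vT v by blast
  qed
qed

lemma op0_tensor_power:
  assumes "w \<in> elts (tensor_power n m)"
  defines "p \<equiv> first1 (map letter_value w)"
  shows "\<not> (p < length w \<and> \<not> primed (w ! p)) \<Longrightarrow> fop (tensor_power n m) (Op 0) w = None"
    and "p < length w \<Longrightarrow> \<not> primed (w ! p) \<Longrightarrow> \<exists>v\<in>elts (tensor_power n m).
      fop (tensor_power n m) (Op 0) w = Some v \<and> map letter_value v = map letter_value w \<and> map primed v = toggle p (map primed w)"
    and "\<not> (p < length w \<and> primed (w ! p)) \<Longrightarrow> eop (tensor_power n m) (Op 0) w = None"
    and "p < length w \<Longrightarrow> primed (w ! p) \<Longrightarrow> \<exists>v\<in>elts (tensor_power n m).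
      eop (tensor_power n m) (Op 0) w = Some v \<and> map letter_value v = map letter_value w \<and> map primed v = toggle p (map primed w)"
proof -
  have "(\<not> (p < length w \<and> \<not> primed (w ! p)) \<longrightarrow> fop (tensor_power n m) (Op 0) w = None) \<and>
    (p < length w \<longrightarrow> \<not> primed (w ! p) \<longrightarrow> (\<exists>v\<in>elts (tensor_power n m).
      fop (tensor_power n m) (Op 0) w = Some v \<and> map letter_value v = map letter_value w \<and> map primed v = toggle p (map primed w))) \<and>
    (\<not> (p < length w \<and> primed (w ! p)) \<longrightarrow> eop (tensor_power n m) (Op 0) w = None) \<and>
    (p < length w \<longrightarrow> primed (w ! p) \<longrightarrow> (\<exists>v\<in>elts (tensor_power n m).
      eop (tensor_power n m) (Op 0) w = Some v \<and> map letter_value v = map letter_value w \<and> map primed v = toggle p (map primed w)))"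
    using assms(1) unfolding p_def
  proof (induction m arbitrary: w)
    case (Suc m)
    let ?T = "tensor_power n m"
    obtain b c where w: "w = b # c" "b \<in> elts (std_crystal n)" "c \<in> elts ?T"
      using Suc.prems by (auto simp only: elts_tensor_power_Suc)
    show ?case
    proof (cases "letter_value b = 1")
      case True
      then have "b = Box 1 \<or> b = Prim 1" by (cases b) auto
      moreover have "Box 1 \<in> elts (std_crystal n)" "Prim 1 \<in> elts (std_crystal n)"
        using w True by (auto simp: elts_std)
      ultimately show ?thesis using w
        by (auto simp: tensor_power_ops wt_std opt_pair_def toggle_def elts_tensor_power_Suc std_crystal_def unit_wt_def)
    next
      case False
      then have op: "fop (tensor_power n (Suc m)) (Op 0) w = map_option ((#) b) (fop ?T (Op 0) c)"
        "eop (tensor_power n (Suc m)) (Op 0) w = map_option ((#) b) (eop ?T (Op 0) c)"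
        by (cases "fop ?T (Op 0) c"; cases "eop ?T (Op 0) c";
            auto simp: w tensor_power_ops wt_std opt_pair_def)+
      have bex: "\<exists>v\<in>elts ?T. P (b # v) \<Longrightarrow> \<exists>v\<in>elts (tensor_power n (Suc m)). P v" for P
        using w(2) by (metis elts_tensor_power_Suc)
      show ?thesis using Suc.IH[OF w(3)] False unfolding op
        by (auto simp: w(1) toggle_def intro!: bex)
    qed
  qed simp
  then show "\<not> (p < length w \<and> \<not> primed (w ! p)) \<Longrightarrow> fop (tensor_power n m) (Op 0) w = None"
    and "p < length w \<Longrightarrow> \<not> primed (w ! p) \<Longrightarrow> \<exists>v\<in>elts (tensor_power n m).
      fop (tensor_power n m) (Op 0) w = Some v \<and> map letter_value v = map letter_value w \<and> map primed v = toggle p (map primed w)"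
    and "\<not> (p < length w \<and> primed (w ! p)) \<Longrightarrow> eop (tensor_power n m) (Op 0) w = None"
    and "p < length w \<Longrightarrow> primed (w ! p) \<Longrightarrow> \<exists>v\<in>elts (tensor_power n m).
      eop (tensor_power n m) (Op 0) w = Some v \<and> map letter_value v = map letter_value w \<and> map primed v = toggle p (map primed w)"
    by blast+
qed

lemma toggle_toggle [simp]: "toggle p (toggle p m) = m"
  by (cases "p < length m") (simp_all add: toggle_def list_update_beyond)

lemma op0_inverse_tensor_power:
  assumes "c \<in> elts (tensor_power n m)"
  shows "eop (tensor_power n m) (Op 0) c = Some d \<Longrightarrow>
      d \<in> elts (tensor_power n m) \<and> fop (tensor_power n m) (Op 0) d = Some c"
    and "fop (tensor_power n m) (Op 0) c = Some d \<Longrightarrow>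
      d \<in> elts (tensor_power n m) \<and> eop (tensor_power n m) (Op 0) d = Some c"
proof -
  let ?T = "tensor_power n m" and ?p = "first1 (map letter_value c)"
  have swap: "primed (v ! ?p) = (\<not> primed (c ! ?p))" "length v = length c"
    if "map letter_value v = map letter_value c" "map primed v = toggle ?p (map primed c)" "?p < length c" for v
  proof -
    show l: "length v = length c" using that(1) by (metis length_map)
    have "map primed v ! ?p = (\<not> map primed c ! ?p)" using that by (simp add: toggle_def)
    then show "primed (v ! ?p) = (\<not> primed (c ! ?p))" using l that(3) by simp
  qed
  show "d \<in> elts ?T \<and> fop ?T (Op 0) d = Some c" if e: "eop ?T (Op 0) c = Some d"
  proof -
    have p: "?p < length c" "primed (c ! ?p)" using op0_tensor_power(3)[OF assms] e by auto
    then have d: "d \<in> elts ?T" "map letter_value d = map letter_value c" "map primed d = toggle ?p (map primed c)"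
      using op0_tensor_power(4)[OF assms p] e by auto
    note s = swap[OF d(2,3) p(1)]
    obtain c' where "fop ?T (Op 0) d = Some c'" "map letter_value c' = map letter_value d"
      "map primed c' = toggle ?p (map primed d)"
      using op0_tensor_power(2)[OF d(1)] s p d(2) by auto
    then show ?thesis using d word_eqI[of c' c] by simp
  qed
  show "d \<in> elts ?T \<and> eop ?T (Op 0) d = Some c" if e: "fop ?T (Op 0) c = Some d"
  proof -
    have p: "?p < length c" "\<not> primed (c ! ?p)" using op0_tensor_power(1)[OF assms] e by auto
    then have d: "d \<in> elts ?T" "map letter_value d = map letter_value c" "map primed d = toggle ?p (map primed c)"
      using op0_tensor_power(2)[OF assms p] e by auto
    note s = swap[OF d(2,3) p(1)]
    obtain c' where "eop ?T (Op 0) d = Some c'" "map letter_value c' = map letter_value d"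
      "map primed c' = toggle ?p (map primed d)"
      using op0_tensor_power(4)[OF d(1)] s p d(2) by auto
    then show ?thesis using d word_eqI[of c' c] by simp
  qed
qed

text \<open>In the tensor product rule for the lowered letter 1, the mark of that letter and the mark of the first 1 to
its right, if there is one, are exchanged.\<close>

lemma fbar1_Cons:
  assumes "2 \<le> n"
  shows "fop (tensor_power n (Suc m)) Bar1 (b # c) =
    (if letter_value b \<noteq> 1 \<and> letter_value b \<noteq> 2 then map_option ((#) b) (fop (tensor_power n m) Bar1 c)
     else if b = Box 1 then
       Some (case eop (tensor_power n m) (Op 0) c of None \<Rightarrow> Box 2 # c | Some d \<Rightarrow> Prim 2 # d)
     else if b = Prim 1 then
       Some (case fop (tensor_power n m) (Op 0) c of None \<Rightarrow> Prim 2 # c | Some d \<Rightarrow> Box 2 # d)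
     else None)"
  using assms by (cases b; cases "fop (tensor_power n m) Bar1 c"; cases "eop (tensor_power n m) (Op 0) c";
      cases "fop (tensor_power n m) (Op 0) c")
    (auto simp: tensor_power_ops wt_std opt_pair_def std_crystal_def unit_wt_def)

text \<open>Since exchanging marks is invertible, a preimage exists for either mark on the leading 2.\<close>

lemma fbar1_image:
  assumes n: "2 \<le> n" and "w \<in> elts (tensor_power n m)"
  shows "(\<exists>v\<in>elts (tensor_power n m). fop (tensor_power n m) Bar1 v = Some w) \<longleftrightarrow> starts_with_2 (map letter_value w)"
  using assms(2)
proof (induction m arbitrary: w)
  case 0
  then show ?case by (simp add: starts_with_2_def)
next
  case (Suc m)
  let ?T = "tensor_power n m"
  obtain b c where w: "w = b # c" "b \<in> elts (std_crystal n)" "c \<in> elts ?T"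
    using Suc.prems by (auto simp only: elts_tensor_power_Suc)
  have box: "Box 1 \<in> elts (std_crystal n)" "Prim 1 \<in> elts (std_crystal n)" using n by (auto simp: elts_std)
  have "(\<exists>v\<in>elts (tensor_power n (Suc m)). fop (tensor_power n (Suc m)) Bar1 v = Some w) \<longleftrightarrow>
    (\<exists>a\<in>elts (std_crystal n). \<exists>d\<in>elts ?T. fop (tensor_power n (Suc m)) Bar1 (a # d) = Some (b # c))"
    unfolding w(1) by (auto simp: elts_tensor_power_Suc) blast
  also have "\<dots> \<longleftrightarrow> starts_with_2 (map letter_value w)"
  proof (cases "letter_value b = 1 \<or> letter_value b = 2")
    case False
    then have "fop (tensor_power n (Suc m)) Bar1 (a # d) = Some (b # c) \<longleftrightarrow> a = b \<and> fop ?T Bar1 d = Some c" for a d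
      unfolding fbar1_Cons[OF n] by (auto split: option.splits)
    moreover have "starts_with_2 (map letter_value w) = starts_with_2 (map letter_value c)"
      using False w(1) by (simp add: starts_with_2_def)
    ultimately show ?thesis using Suc.IH[OF w(3)] w(2) by auto
  next
    case True
    have "fop (tensor_power n (Suc m)) Bar1 (a # d) \<noteq> Some (b # c)" if "letter_value b = 1" for a d
      unfolding fbar1_Cons[OF n] using that by (auto split: option.splits)
    moreover have "\<exists>a\<in>elts (std_crystal n). \<exists>d\<in>elts ?T. fop (tensor_power n (Suc m)) Bar1 (a # d) = Some (b # c)"
      if "letter_value b = 2"
    proof (cases "primed b")
      case True
      then have b: "b = Prim 2" using that by (cases b) auto
      show ?thesis
      proof (cases "fop ?T (Op 0) c")
        case None
        then show ?thesis using b w(3) box by (intro bexI[of _ "Prim 1"] bexI[of _ c]) (auto simp: fbar1_Cons[OF n])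
      next
        case (Some d)
        then show ?thesis using b box op0_inverse_tensor_power(2)[OF w(3) Some]
          by (intro bexI[of _ "Box 1"] bexI[of _ d]) (auto simp: fbar1_Cons[OF n])
      qed
    next
      case False
      then have b: "b = Box 2" using that by (cases b) auto
      show ?thesis
      proof (cases "eop ?T (Op 0) c")
        case None
        then show ?thesis using b w(3) box by (intro bexI[of _ "Box 1"] bexI[of _ c]) (auto simp: fbar1_Cons[OF n])
      next
        case (Some d)
        then show ?thesis using b box op0_inverse_tensor_power(1)[OF w(3) Some]
          by (intro bexI[of _ "Prim 1"] bexI[of _ d]) (auto simp: fbar1_Cons[OF n])
      qed
    qed
    ultimately show ?thesis using True w(1) by (auto simp: starts_with_2_def)
  qed
  finally show ?case .
qed

section \<open>Crystals modelled on marked words\<close>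

text \<open>What the claim needs to know about a component \<open>X\<close>: each element has a word \<open>U\<close> and marks \<open>M\<close> that
determine it and on which the operators act as computed above. The last assumption is there because
the barred \<open>f\<^sub>i\<close> use an inverse of a product of reflections on all of \<open>B\<close>, which must not lead out
of \<open>X\<close>.\<close>

locale word_model =
  fixes n :: nat and B :: "'b crystal" and X :: "'b set"
    and U :: "'b \<Rightarrow> nat list" and M :: "'b \<Rightarrow> bool list"
  assumes X_sub: "X \<subseteq> elts B"
    and len: "x \<in> X \<Longrightarrow> length (M x) = length (U x)"
    and inj: "x \<in> X \<Longrightarrow> y \<in> X \<Longrightarrow> U x = U y \<Longrightarrow> M x = M y \<Longrightarrow> x = y"
    and f_none: "1 \<le> i \<Longrightarrow> i < n \<Longrightarrow> x \<in> X \<Longrightarrow> phi_word i (Suc i) (U x) = 0 \<Longrightarrow> fop B (Op i) x = None"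
    and f_some: "1 \<le> i \<Longrightarrow> i < n \<Longrightarrow> x \<in> X \<Longrightarrow> 0 < phi_word i (Suc i) (U x) \<Longrightarrow>
      \<exists>y\<in>X. fop B (Op i) x = Some y \<and> U y = lower i (Suc i) (U x) \<and> M y = M x"
    and e_none: "1 \<le> i \<Longrightarrow> i < n \<Longrightarrow> x \<in> X \<Longrightarrow> eps_word i (Suc i) (U x) = 0 \<Longrightarrow> eop B (Op i) x = None"
    and e_some: "1 \<le> i \<Longrightarrow> i < n \<Longrightarrow> x \<in> X \<Longrightarrow> 0 < eps_word i (Suc i) (U x) \<Longrightarrow>
      \<exists>y\<in>X. eop B (Op i) x = Some y \<and> U y = raise i (Suc i) (U x) \<and> M y = M x"
    and f0_none: "x \<in> X \<Longrightarrow> \<not> (first1 (U x) < length (U x) \<and> \<not> M x ! first1 (U x)) \<Longrightarrow> fop B (Op 0) x = None"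
    and f0_some: "x \<in> X \<Longrightarrow> first1 (U x) < length (U x) \<Longrightarrow> \<not> M x ! first1 (U x) \<Longrightarrow>
      \<exists>y\<in>X. fop B (Op 0) x = Some y \<and> U y = U x \<and> M y = toggle (first1 (U x)) (M x)"
    and e0_none: "x \<in> X \<Longrightarrow> \<not> (first1 (U x) < length (U x) \<and> M x ! first1 (U x)) \<Longrightarrow> eop B (Op 0) x = None"
    and e0_some: "x \<in> X \<Longrightarrow> first1 (U x) < length (U x) \<Longrightarrow> M x ! first1 (U x) \<Longrightarrow>
      \<exists>y\<in>X. eop B (Op 0) x = Some y \<and> U y = U x \<and> M y = toggle (first1 (U x)) (M x)"
    and ebar1_none: "2 \<le> n \<Longrightarrow> x \<in> X \<Longrightarrow> eop B Bar1 x = None \<longleftrightarrow> \<not> starts_with_2 (U x)"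
    and ebar1_mem: "2 \<le> n \<Longrightarrow> x \<in> X \<Longrightarrow> eop B Bar1 x = Some y \<Longrightarrow> y \<in> X"
    and sigma_reflects: "set is \<subseteq> {1..<n} \<Longrightarrow> y \<in> elts B \<Longrightarrow> x \<in> X \<Longrightarrow> sigma_word B is (Some y) = Some x \<Longrightarrow> y \<in> X"
begin

lemma phi_eq: "1 \<le> i \<Longrightarrow> i < n \<Longrightarrow> x \<in> X \<Longrightarrow> phi B (Op i) x = enat (phi_word i (Suc i) (U x))"
  unfolding phi_def
proof (rule string_length_eq[where X = X and p = "\<lambda>x. phi_word i (Suc i) (U x)"])
  fix x assume i: "1 \<le> i" "i < n" and x: "x \<in> X" "0 < phi_word i (Suc i) (U x)"
  then show "\<exists>y\<in>X. fop B (Op i) x = Some y \<and> Suc (phi_word i (Suc i) (U y)) = phi_word i (Suc i) (U x)"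
    using f_some[OF i x] lower_step[of i "Suc i" "U x"] by auto
qed (auto intro: f_none)

lemma eps_eq: "1 \<le> i \<Longrightarrow> i < n \<Longrightarrow> x \<in> X \<Longrightarrow> eps B (Op i) x = enat (eps_word i (Suc i) (U x))"
  unfolding eps_def
proof (rule string_length_eq[where X = X and p = "\<lambda>x. eps_word i (Suc i) (U x)"])
  fix x assume i: "1 \<le> i" "i < n" and x: "x \<in> X" "0 < eps_word i (Suc i) (U x)"
  then show "\<exists>y\<in>X. eop B (Op i) x = Some y \<and> Suc (eps_word i (Suc i) (U y)) = eps_word i (Suc i) (U x)"
    using e_some[OF i x] raise_step[of i "Suc i" "U x"] by auto
qed (auto intro: e_none)

lemma f_power:
  assumes i: "1 \<le> i" "i < n" and x: "x \<in> X"
  shows "k \<le> phi_word i (Suc i) (U x) \<Longrightarrow> \<exists>y\<in>X. (lift (fop B (Op i)) ^^ k) (Some x) = Some y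
    \<and> U y = (lower i (Suc i) ^^ k) (U x) \<and> M y = M x"
proof (induction k)
  case (Suc k)
  then obtain y where y: "y \<in> X" "(lift (fop B (Op i)) ^^ k) (Some x) = Some y"
    "U y = (lower i (Suc i) ^^ k) (U x)" "M y = M x" by auto
  then have "0 < phi_word i (Suc i) (U y)" using lower_funpow[of i "Suc i" k "U x"] Suc.prems by simp
  from f_some[OF i y(1) this] show ?case using y by auto
qed (use x in auto)

lemma e_power:
  assumes i: "1 \<le> i" "i < n" and x: "x \<in> X"
  shows "k \<le> eps_word i (Suc i) (U x) \<Longrightarrow> \<exists>y\<in>X. (lift (eop B (Op i)) ^^ k) (Some x) = Some y
    \<and> U y = (raise i (Suc i) ^^ k) (U x) \<and> M y = M x"
proof (induction k)
  case (Suc k)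
  then obtain y where y: "y \<in> X" "(lift (eop B (Op i)) ^^ k) (Some x) = Some y"
    "U y = (raise i (Suc i) ^^ k) (U x)" "M y = M x" by auto
  then have "0 < eps_word i (Suc i) (U y)" using raise_funpow[of i "Suc i" k "U x"] Suc.prems by simp
  from e_some[OF i y(1) this] show ?case using y by auto
qed (use x in auto)

lemma toggle_mark: "p < length m \<Longrightarrow> toggle p m ! p = (\<not> m ! p)"
  by (simp add: toggle_def)

lemma phi0_eq:
  assumes "x \<in> X"
  shows "phi B (Op 0) x = enat (if first1 (U x) < length (U x) \<and> \<not> M x ! first1 (U x) then 1 else 0)"
  unfolding phi_def
proof (rule string_length_eq[where X = X and
      p = "\<lambda>x. if first1 (U x) < length (U x) \<and> \<not> M x ! first1 (U x) then 1 else 0"])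
  fix y assume y: "y \<in> X" "0 < (if first1 (U y) < length (U y) \<and> \<not> M y ! first1 (U y) then 1 else (0::nat))"
  then have p: "first1 (U y) < length (U y)" "\<not> M y ! first1 (U y)" by (auto split: if_splits)
  obtain z where "z \<in> X" "fop B (Op 0) y = Some z" "U z = U y" "M z = toggle (first1 (U y)) (M y)"
    using f0_some[OF y(1) p] by blast
  then show "\<exists>z\<in>X. fop B (Op 0) y = Some z \<and>
      Suc (if first1 (U z) < length (U z) \<and> \<not> M z ! first1 (U z) then 1 else 0) =
      (if first1 (U y) < length (U y) \<and> \<not> M y ! first1 (U y) then 1 else 0)"
    using p len[OF y(1)] by (intro bexI[of _ z]) (auto simp: toggle_mark)
next
  fix y assume "y \<in> X" "(if first1 (U y) < length (U y) \<and> \<not> M y ! first1 (U y) then 1 else 0) = (0::nat)"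
  then show "fop B (Op 0) y = None" by (intro f0_none) (auto split: if_splits)
qed (rule assms)

lemma eps0_eq:
  assumes "x \<in> X"
  shows "eps B (Op 0) x = enat (if first1 (U x) < length (U x) \<and> M x ! first1 (U x) then 1 else 0)"
  unfolding eps_def
proof (rule string_length_eq[where X = X and
      p = "\<lambda>x. if first1 (U x) < length (U x) \<and> M x ! first1 (U x) then 1 else 0"])
  fix y assume y: "y \<in> X" "0 < (if first1 (U y) < length (U y) \<and> M y ! first1 (U y) then 1 else (0::nat))"
  then have p: "first1 (U y) < length (U y)" "M y ! first1 (U y)" by (auto split: if_splits)
  obtain z where "z \<in> X" "eop B (Op 0) y = Some z" "U z = U y" "M z = toggle (first1 (U y)) (M y)"
    using e0_some[OF y(1) p] by blast
  then show "\<exists>z\<in>X. eop B (Op 0) y = Some z \<and>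
      Suc (if first1 (U z) < length (U z) \<and> M z ! first1 (U z) then 1 else 0) =
      (if first1 (U y) < length (U y) \<and> M y ! first1 (U y) then 1 else 0)"
    using p len[OF y(1)] by (intro bexI[of _ z]) (auto simp: toggle_mark)
next
  fix y assume "y \<in> X" "(if first1 (U y) < length (U y) \<and> M y ! first1 (U y) then 1 else 0) = (0::nat)"
  then show "eop B (Op 0) y = None" by (intro e0_none) (auto split: if_splits)
qed (rule assms)

lemma sigma_reflect_marked:
  assumes "x \<in> X" "i < n"
  shows "\<exists>y\<in>X. sigma B i (Some x) = Some y \<and> (U y, M y) = reflect_marked i (U x, M x)"
proof (cases "i = 0")
  case True
  let ?p = "first1 (U x)"
  consider "length (U x) \<le> ?p" | "?p < length (U x)" "M x ! ?p" | "?p < length (U x)" "\<not> M x ! ?p"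
    by linarith
  then show ?thesis
  proof cases
    case 1
    then show ?thesis using True assms len[OF assms(1)]
      by (auto simp: sigma_def phi0_eq eps0_eq reflect_marked_def toggle_def list_update_beyond)
  next
    case 2
    then show ?thesis using True e0_some[OF assms(1) 2] assms
      by (auto simp: sigma_def phi0_eq eps0_eq reflect_marked_def)
  next
    case 3
    then show ?thesis using True f0_some[OF assms(1) 3] assms
      by (auto simp: sigma_def phi0_eq eps0_eq reflect_marked_def)
  qed
next
  case False
  then have i: "1 \<le> i" "i < n" using assms by auto
  define p q where "p = phi_word i (Suc i) (U x)" and "q = eps_word i (Suc i) (U x)"
  have s: "sigma B i (Some x) = (if q \<le> p then (lift (fop B (Op i)) ^^ (p - q)) (Some x)
      else (lift (eop B (Op i)) ^^ (q - p)) (Some x))"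
    using i assms by (auto simp: sigma_def phi_eq eps_eq p_def q_def nat_diff_distrib' Let_def)
  show ?thesis
    using f_power[OF i assms(1), of "p - q"] e_power[OF i assms(1), of "q - p"] False
    unfolding s by (auto simp: reflect_marked_def reflect_def p_def q_def)
qed

lemma sigma_None [simp]: "sigma B i None = None"
  by (simp add: sigma_def)

lemma sigma_word_simps [simp]:
  "sigma_word B [] x = x" "sigma_word B (i # is) x = sigma B i (sigma_word B is x)"
  by (simp_all add: sigma_word_def)

lemma sigma_word_reflect_marked:
  assumes "x \<in> X" "set is \<subseteq> {..<n}"
  shows "\<exists>y\<in>X. sigma_word B is (Some x) = Some y \<and> (U y, M y) = foldr reflect_marked is (U x, M x)"
  using assms(2)
proof (induction "is")
  case (Cons i "is")
  then obtain y where y: "y \<in> X" "sigma_word B is (Some x) = Some y" "(U y, M y) = foldr reflect_marked is (U x, M x)"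
    by auto
  from sigma_reflect_marked[OF y(1), of i] show ?case using y Cons.prems by auto
qed (use assms in auto)

lemma sigma_word_reflect:
  assumes "x \<in> X" "set is \<subseteq> {1..<n}"
  shows "\<exists>y\<in>X. sigma_word B is (Some x) = Some y \<and> U y = foldr reflect is (U x) \<and> M y = M x"
proof -
  have "set is \<subseteq> {..<n}" "0 \<notin> set is" using assms(2) by auto
  then show ?thesis using sigma_word_reflect_marked[OF assms(1), of "is"] by (auto simp: foldr_reflect_marked_nonzero)
qed

lemma sigma_reflect:
  assumes "x \<in> X" "1 \<le> i" "i < n"
  shows "\<exists>y\<in>X. sigma B i (Some x) = Some y \<and> U y = reflect i (U x) \<and> M y = M x"
  using sigma_word_reflect[OF assms(1), of "[i]"] assms by auto

lemma sigma_word_None [simp]: "sigma_word B is None = None"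
  by (induction "is") auto

text \<open>Reflections never give zero on elements of \<open>X\<close>, so only the innermost operator decides.\<close>

lemma e_bar_none:
  assumes "1 \<le> i" "i < n" "x \<in> X"
  shows "(e_bar B i (Some x) = None \<longleftrightarrow> \<not> starts_with_2 (bar_word i (U x)))
    \<and> (\<forall>y. e_bar B i (Some x) = Some y \<longrightarrow> y \<in> X)"
  using assms
proof (induction i arbitrary: x rule: less_induct)
  case (less i)
  show ?case
  proof (cases "i = 1")
    case True
    have "2 \<le> n" using True less.prems by simp
    then have "eop B Bar1 x = None \<longleftrightarrow> \<not> starts_with_2 (U x)"
      and "\<forall>y. eop B Bar1 x = Some y \<longrightarrow> y \<in> X"
      using ebar1_none ebar1_mem less.prems by blast+
    then show ?thesis by (simp add: True)
  next
    case False
    obtain k where k: "i = Suc k" using less.prems by (cases i) auto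
    then obtain j where "k = Suc j" using False by (cases k) auto
    with k have j: "i = Suc (Suc j)" by simp
    obtain y where y: "y \<in> X" "sigma B (Suc j) (Some x) = Some y" "U y = reflect (Suc j) (U x)"
      using sigma_reflect[of x "Suc j"] less.prems j by auto
    obtain z where z: "z \<in> X" "sigma B (Suc (Suc j)) (Some y) = Some z" "U z = reflect (Suc (Suc j)) (U y)"
      using sigma_reflect[of y "Suc (Suc j)"] less.prems j y by auto
    have e: "e_bar B i (Some x) = sigma B (Suc j) (sigma B (Suc (Suc j)) (e_bar B (Suc j) (Some z)))"
      by (simp add: j y z)
    have p: "bar_word i (U x) = bar_word (Suc j) (U z)" by (simp add: j y z)
    have IH: "(e_bar B (Suc j) (Some z) = None \<longleftrightarrow> \<not> starts_with_2 (bar_word (Suc j) (U z)))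
        \<and> (\<forall>y. e_bar B (Suc j) (Some z) = Some y \<longrightarrow> y \<in> X)"
      using less.IH[of "Suc j" z] less.prems j z by simp
    show ?thesis
    proof (cases "e_bar B (Suc j) (Some z)")
      case None
      then show ?thesis using IH by (simp add: e p)
    next
      case (Some a)
      then obtain a' where a': "a' \<in> X" "sigma B (Suc (Suc j)) (Some a) = Some a'"
        using IH sigma_reflect[of a "Suc (Suc j)"] less.prems j by auto
      then obtain a'' where "a'' \<in> X" "sigma B (Suc j) (Some a') = Some a''"
        using sigma_reflect[of a' "Suc j"] less.prems j by auto
      then show ?thesis using IH Some a' by (simp add: e p)
    qed
  qed
qed

lemma conj_none:
  assumes "1 \<le> i" "i \<le> n" "x \<in> X"
  defines "p \<equiv> first1 (foldr reflect [1..<i] (U x))"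
  shows "e0_conj B i (Some x) = None \<longleftrightarrow> (p < length (U x) \<longrightarrow> \<not> M x ! p)"
    and "f0_conj B i (Some x) = None \<longleftrightarrow> (p < length (U x) \<longrightarrow> M x ! p)"
proof -
  have s: "set [1..<i] \<subseteq> {1..<n}" "set (rev [1..<i]) \<subseteq> {1..<n}" using assms by auto
  obtain y where y: "y \<in> X" "sigma_word B [1..<i] (Some x) = Some y"
    "U y = foldr reflect [1..<i] (U x)" "M y = M x"
    using sigma_word_reflect[OF assms(3) s(1)] by auto
  have l: "length (U y) = length (U x)" by (simp add: y)
  have py: "first1 (U y) = p" by (simp add: y p_def)
  have rev_none: "sigma_word B (rev [1..<i]) z = None \<longleftrightarrow> z = None" if "\<And>w. z = Some w \<Longrightarrow> w \<in> X" for z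
    using sigma_word_reflect[OF _ s(2)] that by (cases z) fastforce+
  have "eop B (Op 0) y = None \<longleftrightarrow> (p < length (U x) \<longrightarrow> \<not> M x ! p)" "\<And>w. eop B (Op 0) y = Some w \<Longrightarrow> w \<in> X"
    using e0_none[OF y(1), unfolded py l y(4)] e0_some[OF y(1), unfolded py l y(4)]
    by (cases "p < length (U x) \<and> M x ! p"; auto)+
  then show "e0_conj B i (Some x) = None \<longleftrightarrow> (p < length (U x) \<longrightarrow> \<not> M x ! p)"
    unfolding e0_conj_def y(2) by (subst rev_none) auto
  have "fop B (Op 0) y = None \<longleftrightarrow> (p < length (U x) \<longrightarrow> M x ! p)" "\<And>w. fop B (Op 0) y = Some w \<Longrightarrow> w \<in> X"
    using f0_none[OF y(1), unfolded py l y(4)] f0_some[OF y(1), unfolded py l y(4)]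
    by (cases "p < length (U x) \<and> \<not> M x ! p"; auto)+
  then show "f0_conj B i (Some x) = None \<longleftrightarrow> (p < length (U x) \<longrightarrow> M x ! p)"
    unfolding f0_conj_def y(2) by (subst rev_none) auto
qed

lemma foldr_reflect_rev: "foldr reflect is (foldr reflect (rev is) u) = u"
  by (induction "is" arbitrary: u) auto

text \<open>The inverse of the product of reflections picks some preimage of \<open>x\<close> in \<open>B\<close>. It lies in \<open>X\<close> by
\<open>sigma_reflects\<close>, and \<open>c\<close> is its word.\<close>

lemma f_bar'_none:
  assumes "x \<in> X"
  shows "\<exists>c. U x = foldr reflect (word_w0 n) c \<and>
    (\<forall>i. 1 \<le> i \<longrightarrow> i < n \<longrightarrow> f_bar' n B i (Some x) = None \<longleftrightarrow> \<not> starts_with_2 (bar_word (n - i) c))"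
proof -
  let ?A = "insert None (Some ` elts B)"
  have s: "set (rev (word_w0 n)) \<subseteq> {1..<n}" using set_word_w0 by simp
  obtain y where y: "y \<in> X" "U y = foldr reflect (rev (word_w0 n)) (U x)" "M y = M x"
    using sigma_word_reflect[OF assms s] by auto
  obtain y' where "y' \<in> X" "sigma_w0 n B (Some y) = Some y'" "U y' = foldr reflect (word_w0 n) (U y)" "M y' = M y"
    using sigma_word_reflect[OF y(1) set_word_w0] by (auto simp: sigma_w0_def)
  then have "sigma_w0 n B (Some y) = Some x"
    using inj[of y' x] assms y by (simp add: foldr_reflect_rev)
  then have im: "Some x \<in> sigma_w0 n B ` ?A" using y(1) X_sub by (intro image_eqI[of _ _ "Some y"]) auto
  define z where "z = inv_into ?A (sigma_w0 n B) (Some x)"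
  have z: "z \<in> ?A" "sigma_w0 n B z = Some x"
    unfolding z_def using im by (auto simp only: inv_into_into f_inv_into_f)
  then obtain c where c: "z = Some c" "c \<in> elts B" by (auto simp: sigma_w0_def)
  have cX: "c \<in> X" using sigma_reflects[OF set_word_w0 c(2) assms] z c(1) by (simp add: sigma_w0_def)
  have Uc: "U x = foldr reflect (word_w0 n) (U c)"
    using sigma_word_reflect[OF cX set_word_w0] z c(1) by (auto simp: sigma_w0_def)
  have "f_bar' n B i (Some x) = None \<longleftrightarrow> \<not> starts_with_2 (bar_word (n - i) (U c))" if i: "1 \<le> i" "i < n" for i
  proof -
    have "f_bar' n B i (Some x) = sigma_w0 n B (e_bar B (n - i) (Some c))"
      by (simp add: f_bar'_def z_def[symmetric] c(1))
    moreover have "sigma_w0 n B e = None \<longleftrightarrow> e = None" if "\<And>w. e = Some w \<Longrightarrow> w \<in> X" for e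
      using that sigma_word_reflect[OF _ set_word_w0] by (cases e) (fastforce simp: sigma_w0_def)+
    ultimately show ?thesis using e_bar_none[of "n - i" c] i cX by simp
  qed
  then show ?thesis using Uc by blast
qed

lemma fst_foldr_reflect_marked_w0_plus: "fst (foldr reflect_marked (word_w0_plus k) s) = foldr reflect (word_w0 k) (fst s)"
proof (induction k arbitrary: s)
  case (Suc k)
  obtain u m where s: "s = (u, m)" by (cases s)
  show ?case using Suc.IH
    by (simp add: s word_w0_plus_Suc word_w0_Suc reflect_marked_def[of 0] foldr_reflect_marked_nonzero del: upt_Suc)
qed (simp add: word_w0_plus_def word_w0_def)

lemma set_word_w0_plus: "set (word_w0_plus n) \<subseteq> {..<n}"
  by (auto simp: word_w0_plus_def)

text \<open>Each side makes \<open>U x\<close> a lowest weight word. Then the word of the image \<open>d\<close> and the word \<open>c\<close> at which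
the barred \<open>f\<^sub>i\<close> are evaluated are extremal of equal content, hence equal. This matches the
barred conditions, and \<open>marks_flipped\<close> matches the conditions on the marks.\<close>

theorem lowest_iff_highest:
  assumes "1 \<le> n" "x \<in> X"
  shows "lowest_weight_element n B x \<longleftrightarrow>
    (\<exists>c\<in>elts B. sigma_w0_plus n B (Some x) = Some c \<and> highest_weight_element n B c)"
proof -
  obtain d where d: "d \<in> X" "sigma_w0_plus n B (Some x) = Some d"
    "(U d, M d) = foldr reflect_marked (word_w0_plus n) (U x, M x)"
    using sigma_word_reflect_marked[OF assms(2) set_word_w0_plus] by (auto simp: sigma_w0_plus_def)
  have Ud: "U d = foldr reflect (word_w0 n) (U x)"
    using fst_foldr_reflect_marked_w0_plus[of n "(U x, M x)"] d(3) by (metis fst_conv)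
  obtain c where c: "U x = foldr reflect (word_w0 n) c"
    "\<And>i. 1 \<le> i \<Longrightarrow> i < n \<Longrightarrow> f_bar' n B i (Some x) = None \<longleftrightarrow> \<not> starts_with_2 (bar_word (n - i) c)"
    using f_bar'_none[OF assms(2)] by blast
  let ?gl_lowest = "\<forall>i. 1 \<le> i \<longrightarrow> i < n \<longrightarrow> phi_word i (Suc i) (U x) = 0"
  let ?gl_highest = "\<forall>i. 1 \<le> i \<longrightarrow> i < n \<longrightarrow> eps_word i (Suc i) (U d) = 0"
  have fN: "fop B (Op i) x = None \<longleftrightarrow> phi_word i (Suc i) (U x) = 0" if "1 \<le> i" "i < n" for i
    using f_none[OF that assms(2)] f_some[OF that assms(2)] by fastforce
  have eN: "eop B (Op i) d = None \<longleftrightarrow> eps_word i (Suc i) (U d) = 0" if "1 \<le> i" "i < n" for i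
    using e_none[OF that d(1)] e_some[OF that d(1)] by fastforce
  have crystal_class_d: "crystal_class n (U d) = crystal_class n (U x)" and crystal_class_c: "crystal_class n (U x) = crystal_class n c"
    unfolding Ud c(1) using foldr_reflect_extremal(1)[OF set_word_w0] by auto
  have cnt_d: "count_list (U d) j = count_list (U x) (Suc n - j)" if "1 \<le> j" "j \<le> n" for j
    using that by (simp add: Ud count_w0)
  have cnt_c: "count_list (U x) j = count_list c (Suc n - j)" if "1 \<le> j" "j \<le> n" for j
    using that by (simp add: c(1) count_w0)
  have lowest: "lowest_weight_element n B x \<longleftrightarrow> ?gl_lowest \<and>
      (\<forall>i. 1 \<le> i \<longrightarrow> i < n \<longrightarrow> \<not> starts_with_2 (bar_word (n - i) c)) \<and>
      (\<forall>i\<in>{1..n}. first1 (foldr reflect [1..<i] (U x)) < length (U x) \<longrightarrow> M x ! first1 (foldr reflect [1..<i] (U x)))"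
    using assms(2) X_sub fN c(2) conj_none(2)[OF _ _ assms(2)]
    by (auto simp: lowest_weight_element_def)
  have "(\<exists>c\<in>elts B. sigma_w0_plus n B (Some x) = Some c \<and> highest_weight_element n B c)
      \<longleftrightarrow> highest_weight_element n B d"
    using d X_sub by auto
  also have "\<dots> \<longleftrightarrow> ?gl_highest \<and> (\<forall>i. 1 \<le> i \<longrightarrow> i < n \<longrightarrow> \<not> starts_with_2 (bar_word i (U d))) \<and>
      (\<forall>i\<in>{1..n}. first1 (foldr reflect [1..<i] (U d)) < length (U x) \<longrightarrow> \<not> M d ! first1 (foldr reflect [1..<i] (U d)))"
    using d(1) X_sub eN e_bar_none[OF _ _ d(1)] conj_none(1)[OF _ _ d(1)] crystal_class_length[OF crystal_class_d]
    by (auto simp: highest_weight_element_def)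
  also have "\<dots> \<longleftrightarrow> lowest_weight_element n B x"
  proof -
    have gl_high_imp_lower: ?gl_lowest if ?gl_highest
    proof (intro allI impI)
      fix i assume i: "1 \<le> i" "i < n"
      have "extremal n (U d)" using that by (intro extremal_highest) auto
      then have "extremal n (foldr reflect (rev (word_w0 n)) (U d))"
        using foldr_reflect_extremal(2) set_word_w0 by (metis set_rev)
      moreover have "foldr reflect (rev (word_w0 n)) (U d) = U x"
        using foldr_reflect_rev[of "rev (word_w0 n)" "U x"] by (simp add: Ud)
      ultimately have "extremal n (U x)" by simp
      moreover have "phi_word (n - i) (Suc (n - i)) (U d) + count_list (U d) (Suc (n - i))
          = eps_word (n - i) (Suc (n - i)) (U d) + count_list (U d) (n - i)"
        by (rule phi_eps_count) simp
      moreover have "eps_word (n - i) (Suc (n - i)) (U d) = 0" using that i by simp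
      ultimately show "phi_word i (Suc i) (U x) = 0"
        using cnt_d[of "n - i"] cnt_d[of "Suc (n - i)"] i by (intro extremal_phi) (auto simp: Suc_diff_le)
    qed
    show ?thesis
    proof (cases ?gl_lowest)
      case False
      then show ?thesis using lowest gl_high_imp_lower by blast
    next
      case True
      have ext: "extremal n (U x)" using True by (intro extremal_lowest) auto
      have ext_d: "extremal n (U d)" using foldr_reflect_extremal(2)[OF set_word_w0 ext] by (simp add: Ud)
      have "c = foldr reflect (rev (word_w0 n)) (U x)"
        using foldr_reflect_rev[of "rev (word_w0 n)" c] by (simp add: c(1))
      then have ext_c: "extremal n c"
        using foldr_reflect_extremal(2)[OF _ ext, of "rev (word_w0 n)"] set_word_w0 by simp
      \<comment> \<open>Both contents are the reversal of the content of \<open>U x\<close>.\<close>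
      have "c = U d"
      proof (rule extremal_unique[OF ext_c ext_d])
        fix k assume "k \<in> {1..n}"
        then show "count_list c k = count_list (U d) k" using cnt_d[of k] cnt_c[of "Suc n - k"] by auto
      qed (simp add: crystal_class_d crystal_class_c)
      have dom: "count_list (U d) (Suc i) \<le> count_list (U d) i" if i: "1 \<le> i" "i < n" for i
      proof -
        have "phi_word (n - i) (Suc (n - i)) (U x) + count_list (U x) (Suc (n - i))
            = eps_word (n - i) (Suc (n - i)) (U x) + count_list (U x) (n - i)"
          by (rule phi_eps_count) simp
        moreover have "phi_word (n - i) (Suc (n - i)) (U x) = 0" using True i by simp
        ultimately show ?thesis using cnt_d[of i] cnt_d[of "Suc i"] i by (auto simp: Suc_diff_le)
      qed
      have high: ?gl_highest using extremal_eps[OF ext_d] dom by blast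
      have bars: "(\<forall>i. 1 \<le> i \<longrightarrow> i < n \<longrightarrow> \<not> starts_with_2 (bar_word (n - i) c))
          \<longleftrightarrow> (\<forall>i. 1 \<le> i \<longrightarrow> i < n \<longrightarrow> \<not> starts_with_2 (bar_word i (U d)))"
        unfolding \<open>c = U d\<close>
      proof (intro iffI allI impI)
        fix i assume *: "\<forall>i. 1 \<le> i \<longrightarrow> i < n \<longrightarrow> \<not> starts_with_2 (bar_word (n - i) (U d))" "1 \<le> i" "i < n"
        then show "\<not> starts_with_2 (bar_word i (U d))" using *(1)[rule_format, of "n - i"] by simp
      qed auto
      have Md: "M d = fold toggle (map (\<lambda>j. first_pos n (U x) (count_list (U x) j)) [1..<Suc n]) (M x)"
        using foldr_reflect_marked_w0_plus[OF assms(1) order_refl ext, of "M x"] d(3) by simp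
      have cnt: "count_list (U x) i = count_list (U d) (Suc n - i)" if "1 \<le> i" "i \<le> n" for i
        using cnt_d[of "Suc n - i"] that by auto
      have marks: "(\<forall>i\<in>{1..n}. first1 (foldr reflect [1..<i] (U x)) < length (U x) \<longrightarrow>
            M x ! first1 (foldr reflect [1..<i] (U x))) \<longleftrightarrow>
          (\<forall>i\<in>{1..n}. first1 (foldr reflect [1..<i] (U d)) < length (U x) \<longrightarrow>
            \<not> M d ! first1 (foldr reflect [1..<i] (U d)))"
        if "\<forall>i. 1 \<le> i \<longrightarrow> i < n \<longrightarrow> \<not> starts_with_2 (bar_word i (U d))"
        unfolding Md
        by (rule marks_flipped[OF assms(1) ext ext_d crystal_class_d[symmetric] cnt dom _ len[OF assms(2)]])
          (use that in auto)
      show ?thesis unfolding lowest bars by (rule iffI; elim conjE; intro conjI) (use True high marks in fast)+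
    qed
  qed
  finally show ?thesis by blast
qed

end

section \<open>Components of normal crystals\<close>

definition linked :: "nat \<Rightarrow> 'b crystal \<Rightarrow> ('b \<times> 'b) set" where
  "linked n B = (edges n B \<union> (edges n B)\<inverse>)\<^sup>*"

lemma linked_sym: "(x, y) \<in> linked n B \<Longrightarrow> (y, x) \<in> linked n B"
  unfolding linked_def by (rule symD[OF sym_rtrancl[OF sym_Un_converse]])

lemma linked_trans: "(x, y) \<in> linked n B \<Longrightarrow> (y, z) \<in> linked n B \<Longrightarrow> (x, z) \<in> linked n B"
  unfolding linked_def by (rule rtrancl_trans)

lemma linked_fop:
  assumes "i \<in> labels n" "x \<in> elts B" "y \<in> elts B" "fop B i x = Some y"
  shows "(x, y) \<in> linked n B"
  using assms unfolding linked_def edges_def by (intro r_into_rtrancl) auto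

lemma weak_component_linked: "c \<in> weak_component n B b \<longleftrightarrow> c \<in> elts B \<and> (b, c) \<in> linked n B"
  by (simp add: weak_component_def linked_def)

lemma labels_cases:
  assumes "i \<in> labels n"
  obtains "i = Op 0" | j where "i = Op j" "1 \<le> j" "j < n" | "i = Bar1" "2 \<le> n"
  using assms by (cases i) (auto simp: labels_def Suc_le_eq split: if_splits)

context qp_crystal
begin

lemma fop_mem:
  assumes "i \<in> labels n" "x \<in> elts B" "fop B i x = Some y"
  shows "y \<in> elts B"
  using assms(1)
proof (cases rule: labels_cases)
  case 1
  then show ?thesis using f0_closed[OF assms(2)] assms(3) by simp
next
  case (2 j)
  then show ?thesis using fop_closed[OF assms(2), of j] assms(3) by simp
next
  case 3
  then show ?thesis using fbar1_closed[OF _ assms(2)] assms(3) by simp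
qed

lemma eop_mem:
  assumes "i \<in> labels n" "x \<in> elts B" "eop B i x = Some y"
  shows "y \<in> elts B"
  using assms(1)
proof (cases rule: labels_cases)
  case 1
  then show ?thesis using e0_closed[OF assms(2)] assms(3) by simp
next
  case (2 j)
  then show ?thesis using eop_closed[OF assms(2), of j] assms(3) by simp
next
  case 3
  then show ?thesis using ebar1_closed[OF _ assms(2)] assms(3) by simp
qed

lemma eop_iff_fop:
  assumes "i \<in> labels n" "x \<in> elts B" "y \<in> elts B"
  shows "eop B i x = Some y \<longleftrightarrow> fop B i y = Some x"
  using assms(1)
proof (cases rule: labels_cases)
  case 1
  then show ?thesis using Q1_inverse[OF assms(2,3)] by simp
next
  case (2 j)
  then show ?thesis using S1_inverse[OF assms(2,3), of j] by simp
next
  case 3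
  then show ?thesis using P1_inverse[OF _ assms(2,3)] by simp
qed

end

lemma (in qp_crystal) eop_linked:
  "i \<in> labels n \<Longrightarrow> x \<in> elts B \<Longrightarrow> eop B i x = Some y \<Longrightarrow> (x, y) \<in> linked n B"
  using eop_iff_fop[of i x y] eop_mem[of i x y] linked_fop[of i n y B x] linked_sym[of y x n B] by blast

lemma lift_power_linked:
  assumes step: "\<And>x y. x \<in> elts B \<Longrightarrow> g x = Some y \<Longrightarrow> y \<in> elts B \<and> (x, y) \<in> linked n B"
    and "x \<in> elts B" "(lift g ^^ k) (Some x) = Some y"
  shows "y \<in> elts B \<and> (x, y) \<in> linked n B"
  using assms(3)
proof (induction k arbitrary: y)
  case 0
  then show ?case using assms(2) by (simp add: linked_def)
next
  case (Suc k)
  then obtain z where z: "(lift g ^^ k) (Some x) = Some z" "g z = Some y"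
    by (cases "(lift g ^^ k) (Some x)") auto
  then show ?case using Suc.IH[OF z(1)] step[of z y] linked_trans[of x z n B y] by blast
qed

lemma (in qp_crystal) sigma_linked:
  assumes "1 \<le> i" "i < n" "x \<in> elts B" "sigma B i (Some x) = Some y"
  shows "y \<in> elts B \<and> (x, y) \<in> linked n B"
proof -
  have l: "Op i \<in> labels n" using assms by (simp add: labels_def)
  have f_step: "v \<in> elts B \<and> (u, v) \<in> linked n B" if "u \<in> elts B" "fop B (Op i) u = Some v" for u v
    using fop_mem[OF l that] linked_fop[OF l that(1) _ that(2)] by simp
  have e_step: "v \<in> elts B \<and> (u, v) \<in> linked n B" if "u \<in> elts B" "eop B (Op i) u = Some v" for u v
    using eop_mem[OF l that] eop_linked[OF l that] by simp
  have "y \<in> elts B \<and> (x, y) \<in> linked n B" if "(lift (fop B (Op i)) ^^ k) (Some x) = Some y" for k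
    using lift_power_linked[OF f_step assms(3) that] .
  moreover have "y \<in> elts B \<and> (x, y) \<in> linked n B" if "(lift (eop B (Op i)) ^^ k) (Some x) = Some y" for k
    using lift_power_linked[OF e_step assms(3) that] .
  ultimately show ?thesis using assms(4) by (auto simp: sigma_def Let_def split: if_splits)
qed

lemma (in qp_crystal) sigma_word_linked:
  assumes "set is \<subseteq> {1..<n}" "x \<in> elts B" "sigma_word B is (Some x) = Some y"
  shows "y \<in> elts B \<and> (x, y) \<in> linked n B"
  using assms(1,3)
proof (induction "is" arbitrary: y)
  case Nil
  then show ?case using assms(2) by (simp add: sigma_word_def linked_def)
next
  case (Cons i "is")
  then have s: "sigma B i (sigma_word B is (Some x)) = Some y" by (simp add: sigma_word_def)
  then obtain z where z: "sigma_word B is (Some x) = Some z"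
    by (cases "sigma_word B is (Some x)") (auto simp: sigma_def)
  have "z \<in> elts B \<and> (x, z) \<in> linked n B" using Cons.IH[OF _ z] Cons.prems by simp
  moreover have "sigma B i (Some z) = Some y" using s z by simp
  ultimately show ?case using sigma_linked[of i z y] Cons.prems linked_trans[of x z n B y] by auto
qed

text \<open>An isomorphism of graphs is only required to respect the lowering operators between elements of the
components. Because components are closed under all arrows, it also tells where arrows are missing, and
the raising operators follow by inverting arrows.\<close>

lemma normal_component:
  assumes "normal_qp_crystal n B" "b \<in> elts B"
  obtains h m where "inj_on h (weak_component n B b)" "h ` weak_component n B b \<subseteq> elts (tensor_power n m)"
    "\<And>i x. i \<in> labels n \<Longrightarrow> x \<in> weak_component n B b \<Longrightarrow> fop (tensor_power n m) i (h x) = None \<Longrightarrow>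
      fop B i x = None"
    "\<And>i x v. i \<in> labels n \<Longrightarrow> x \<in> weak_component n B b \<Longrightarrow> v \<in> elts (tensor_power n m) \<Longrightarrow>
      fop (tensor_power n m) i (h x) = Some v \<Longrightarrow> \<exists>y\<in>weak_component n B b. h y = v \<and> fop B i x = Some y"
    "\<And>i x. i \<in> labels n \<Longrightarrow> x \<in> weak_component n B b \<Longrightarrow>
      (\<And>v. v \<in> elts (tensor_power n m) \<Longrightarrow> fop (tensor_power n m) i v \<noteq> Some (h x)) \<Longrightarrow> eop B i x = None"
    "\<And>i x v. i \<in> labels n \<Longrightarrow> x \<in> weak_component n B b \<Longrightarrow> v \<in> elts (tensor_power n m) \<Longrightarrow>
      fop (tensor_power n m) i v = Some (h x) \<Longrightarrow> \<exists>y\<in>weak_component n B b. h y = v \<and> eop B i x = Some y"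
proof -
  interpret qp_crystal n B using assms(1) by (simp add: normal_qp_crystal_def)
  let ?X = "weak_component n B b"
  have "B\<lparr>elts := ?X\<rparr> \<in> full_subcrystals n B"
    using assms(2) unfolding full_subcrystals_def by blast
  then obtain m Y where "Y \<in> full_subcrystals n (tensor_power n m)" "isomorphic n (B\<lparr>elts := ?X\<rparr>) Y"
    using assms(1) unfolding normal_qp_crystal_def by meson
  then obtain y0 h where iso: "crystal_iso n (B\<lparr>elts := ?X\<rparr>)
      ((tensor_power n m)\<lparr>elts := weak_component n (tensor_power n m) y0\<rparr>) h"
    unfolding full_subcrystals_def isomorphic_def by auto
  let ?T = "tensor_power n m"
  let ?Y = "weak_component n ?T y0"
  have bij: "bij_betw h ?X ?Y"
    and op: "\<And>i x y. i \<in> labels n \<Longrightarrow> x \<in> ?X \<Longrightarrow> y \<in> ?X \<Longrightarrow>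
      fop B i x = Some y \<longleftrightarrow> fop ?T i (h x) = Some (h y)"
    using iso by (auto simp: crystal_iso_def)
  have hY: "h x \<in> ?Y" if "x \<in> ?X" for x using bij that by (auto simp: bij_betw_def)
  have surj: "\<exists>x\<in>?X. h x = v" if "v \<in> ?Y" for v
    using bij that unfolding bij_betw_def by (metis imageE)
  have X_closed: "y \<in> ?X" if "x \<in> ?X" "y \<in> elts B" "(x, y) \<in> linked n B" for x y
    using that linked_trans[of b x n B y] by (simp add: weak_component_linked)
  have Y_closed: "w \<in> ?Y" if "v \<in> ?Y" "w \<in> elts ?T" "(v, w) \<in> linked n ?T" for v w
    using that linked_trans[of y0 v n ?T w] by (simp add: weak_component_linked)
  have in_B: "x \<in> elts B" if "x \<in> ?X" for x using that by (simp add: weak_component_linked)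
  have in_T: "v \<in> elts ?T" if "v \<in> ?Y" for v using that by (simp add: weak_component_linked)
  show thesis
  proof (rule that[of h m])
    show "inj_on h ?X" using bij by (simp add: bij_betw_def)
    show "h ` ?X \<subseteq> elts ?T" using hY in_T by blast
  next
    fix i x assume i: "i \<in> labels n" and x: "x \<in> ?X"
    note xB = in_B[OF x]
    show "fop B i x = None" if "fop ?T i (h x) = None"
    proof (cases "fop B i x")
      case (Some y)
      have "y \<in> elts B" using fop_mem[OF i xB Some] .
      then have "y \<in> ?X" using X_closed[OF x _ linked_fop[OF i xB _ Some]] by blast
      then show ?thesis using op[OF i x, of y] Some that by simp
    qed simp
    show "\<exists>y\<in>?X. h y = v \<and> fop B i x = Some y" if v: "v \<in> elts ?T" "fop ?T i (h x) = Some v" for v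
    proof -
      have "v \<in> ?Y" using Y_closed[OF hY[OF x] v(1) linked_fop[OF i in_T[OF hY[OF x]] v]] .
      then obtain y where y: "y \<in> ?X" "h y = v" using surj by blast
      then have "fop B i x = Some y" using op[OF i x y(1)] v by simp
      then show ?thesis using y by blast
    qed
    show "eop B i x = None" if none: "\<And>v. v \<in> elts ?T \<Longrightarrow> fop ?T i v \<noteq> Some (h x)"
    proof (cases "eop B i x")
      case (Some y)
      have y: "y \<in> ?X"
        using X_closed[OF x eop_mem[OF i xB Some] eop_linked[OF i xB Some]] .
      then have "fop ?T i (h y) = Some (h x)"
        using Some eop_iff_fop[OF i xB in_B[OF y]] op[OF i y x] by simp
      then show ?thesis using none[OF in_T[OF hY[OF y]]] by simp
    qed simp
    show "\<exists>y\<in>?X. h y = v \<and> eop B i x = Some y" if v: "v \<in> elts ?T" "fop ?T i v = Some (h x)" for v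
    proof -
      have "v \<in> ?Y"
        using Y_closed[OF hY[OF x] v(1) linked_sym[OF linked_fop[OF i v(1) in_T[OF hY[OF x]] v(2)]]] .
      then obtain y where y: "y \<in> ?X" "h y = v" using surj by blast
      then have "eop B i x = Some y" using op[OF i y(1) x] v eop_iff_fop[OF i xB in_B[OF y(1)]] by simp
      then show ?thesis using y by blast
    qed
  qed
qed

lemma normal_word_model:
  assumes "1 \<le> n" "normal_qp_crystal n B" "b \<in> elts B"
  shows "\<exists>U M. word_model n B (weak_component n B b) U M"
proof -
  interpret qp_crystal n B using assms(2) by (simp add: normal_qp_crystal_def)
  let ?X = "weak_component n B b"
  obtain h m where inj: "inj_on h ?X" and hT: "h ` ?X \<subseteq> elts (tensor_power n m)"
    and fN: "\<And>i x. i \<in> labels n \<Longrightarrow> x \<in> ?X \<Longrightarrow> fop (tensor_power n m) i (h x) = None \<Longrightarrow> fop B i x = None"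
    and fS: "\<And>i x v. i \<in> labels n \<Longrightarrow> x \<in> ?X \<Longrightarrow> v \<in> elts (tensor_power n m) \<Longrightarrow>
      fop (tensor_power n m) i (h x) = Some v \<Longrightarrow> \<exists>y\<in>?X. h y = v \<and> fop B i x = Some y"
    and eN: "\<And>i x. i \<in> labels n \<Longrightarrow> x \<in> ?X \<Longrightarrow>
      (\<And>v. v \<in> elts (tensor_power n m) \<Longrightarrow> fop (tensor_power n m) i v \<noteq> Some (h x)) \<Longrightarrow> eop B i x = None"
    and eS: "\<And>i x v. i \<in> labels n \<Longrightarrow> x \<in> ?X \<Longrightarrow> v \<in> elts (tensor_power n m) \<Longrightarrow>
      fop (tensor_power n m) i v = Some (h x) \<Longrightarrow> \<exists>y\<in>?X. h y = v \<and> eop B i x = Some y"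
    by (rule normal_component[OF assms(2,3)]) blast
  let ?T = "tensor_power n m"
  have hx: "h x \<in> elts ?T" if "x \<in> ?X" for x using hT that by blast
  have l0: "Op 0 \<in> labels n" and li: "\<And>i. i < n \<Longrightarrow> Op i \<in> labels n" and lb: "2 \<le> n \<Longrightarrow> Bar1 \<in> labels n"
    using assms(1) by (auto simp: labels_def)
  have "word_model n B ?X (\<lambda>x. map letter_value (h x)) (\<lambda>x. map primed (h x))"
  proof
    show "?X \<subseteq> elts B" by (auto simp: weak_component_def)
  next
    fix x y assume "x \<in> ?X" "y \<in> ?X" "map letter_value (h x) = map letter_value (h y)" "map primed (h x) = map primed (h y)"
    then show "x = y" using inj word_eqI by (metis inj_onD)
  next
    fix x assume x: "x \<in> ?X"
    note w = hx[OF x]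
    let ?p = "first1 (map letter_value (h x))"
    show "length (map primed (h x)) = length (map letter_value (h x))" by simp
    show "fop B (Op 0) x = None" if "\<not> (?p < length (map letter_value (h x)) \<and> \<not> map primed (h x) ! ?p)"
      using op0_tensor_power(1)[OF w] that by (intro fN[OF l0 x]) auto
    show "\<exists>y\<in>?X. fop B (Op 0) x = Some y \<and> map letter_value (h y) = map letter_value (h x)
        \<and> map primed (h y) = toggle ?p (map primed (h x))"
      if "?p < length (map letter_value (h x))" "\<not> map primed (h x) ! ?p"
      using op0_tensor_power(2)[OF w] that fS[OF l0 x] by fastforce
    show "eop B (Op 0) x = None" if "\<not> (?p < length (map letter_value (h x)) \<and> map primed (h x) ! ?p)"
    proof (rule eN[OF l0 x])
      fix v assume v: "v \<in> elts ?T"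
      show "fop ?T (Op 0) v \<noteq> Some (h x)"
        using op0_tensor_power(3)[OF w] op0_inverse_tensor_power(2)[OF v, of "h x"] that by auto
    qed
    show "\<exists>y\<in>?X. eop B (Op 0) x = Some y \<and> map letter_value (h y) = map letter_value (h x)
        \<and> map primed (h y) = toggle ?p (map primed (h x))"
      if "?p < length (map letter_value (h x))" "map primed (h x) ! ?p"
      using op0_tensor_power(4)[OF w] that op0_inverse_tensor_power(1)[OF w] eS[OF l0 x] by fastforce
    show "eop B Bar1 x = None \<longleftrightarrow> \<not> starts_with_2 (map letter_value (h x))" if n: "2 \<le> n"
      using fbar1_image[OF n w] eN[OF lb[OF n] x] eS[OF lb[OF n] x] by fastforce
    show "y \<in> ?X" if "2 \<le> n" "eop B Bar1 x = Some y" for y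
    proof -
      have xB: "x \<in> elts B" using x by (simp add: weak_component_linked)
      show ?thesis
        using x eop_mem[OF lb[OF that(1)] xB that(2)] eop_linked[OF lb[OF that(1)] xB that(2)]
          linked_trans[of b x n B y] by (simp add: weak_component_linked)
    qed
    fix i assume i: "1 \<le> i" "i < n"
    note l = li[OF i(2)]
    show "fop B (Op i) x = None" if "phi_word i (Suc i) (map letter_value (h x)) = 0"
      using fop_tensor_power(1)[OF i w that] by (rule fN[OF l x])
    show "\<exists>y\<in>?X. fop B (Op i) x = Some y \<and> map letter_value (h y) = lower i (Suc i) (map letter_value (h x))
        \<and> map primed (h y) = map primed (h x)" if "0 < phi_word i (Suc i) (map letter_value (h x))"
      using fop_tensor_power(2)[OF i w that] fS[OF l x] by metis
    show "eop B (Op i) x = None" if "eps_word i (Suc i) (map letter_value (h x)) = 0"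
      using fop_tensor_power_preimage(1)[OF i w that] by (rule eN[OF l x])
    show "\<exists>y\<in>?X. eop B (Op i) x = Some y \<and> map letter_value (h y) = raise i (Suc i) (map letter_value (h x))
        \<and> map primed (h y) = map primed (h x)" if "0 < eps_word i (Suc i) (map letter_value (h x))"
      using fop_tensor_power_preimage(2)[OF i w that] eS[OF l x] by metis
  next
    fix "is" :: "nat list" and y x
    assume "set is \<subseteq> {1..<n}" "y \<in> elts B" "x \<in> ?X" "sigma_word B is (Some y) = Some x"
    then show "y \<in> ?X"
      using sigma_word_linked[of "is" y x] linked_sym[of y x n B] linked_trans[of b x n B y]
      by (simp add: weak_component_linked)
  qed
  then show ?thesis by blast
qed

theorem proposition7p15:
  fixes n :: nat and B :: "'b crystal" and b :: 'b
  assumes "n \<ge> 1" and "normal_qp_crystal n B" and "b \<in> elts B"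
  shows "lowest_weight_element n B b \<longleftrightarrow>
    (\<exists>c\<in>elts B. sigma_w0_plus n B (Some b) = Some c \<and> highest_weight_element n B c)"
proof -
  obtain U M where "word_model n B (weak_component n B b) U M"
    using normal_word_model[OF assms] by blast
  then interpret word_model n B "weak_component n B b" U M .
  have "b \<in> weak_component n B b" using assms(3) by (simp add: weak_component_def)
  then show ?thesis by (rule lowest_iff_highest[OF assms(1)])
qed

end
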